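(* Let $\mathfrak{g}$ be a symmetrizable Kac--Moody algebra, and let $V$ be a highest weight $U_q(\mathfrak{g})$-module with arbitrary highest weight $\lambda_q$. Fix subsets $J,J'\subset I$. 1. $\operatorname{wt}_JV\subset\operatorname{wt}_{J'}V$ if and only if $J_{\min}\subset J'$. 2. $\operatorname{wt}_JV=\operatorname{wt}_{J'}V$ if and only if $J_{\min}\subset J'\subset J_{\max}$.
   Context: Let $A=(a_{ij})_{i,j\in I}$ be a symmetrizable generalized Cartan matrix ($I$ finite), $\mathfrak{g}=\mathfrak{g}(A)$ the associated Kac--Moody algebra, $D=\operatorname{diag}(d_i)_{i\in I}$ with $d_i\in\mathbb{Z}_{>0}$ and $DA$ symmetric, $(\mathfrak{h},\{\alpha_i\},\{\check\alpha_i\})$ a realization of $A$, and $P^\vee\subset\mathfrak{h}$ a lattice with $\mathbb{Z}$-basis $\check\alpha_i$ ($i\in I$), $\check\beta_l$ ($1\le l\le|I|-\operatorname{rk}A$), such that $P^\vee\otimes_{\mathbb{Z}}\mathbb{C}\simeq\mathfrak{h}$ and $(\check\beta_l,\alpha_i)\in\mathbb{Z}$ for all $i,l$. Let $q$ be an indeterminate and $q_i=q^{d_i}$. $U_q(\mathfrak{g})$ is the $\mathbb{C}(q)$-algebra generated by $e_i,f_i$ ($i\in I$), $q^h$ ($h\in P^\vee$) with relations $q^0=1$, $q^hq^{h'}=q^{h+h'}$, $q^he_iq^{-h}=q^{(h,\alpha_i)}e_i$, $q^hf_iq^{-h}=q^{-(h,\alpha_i)}f_i$, $e_if_j-f_je_i=\delta_{ij}\frac{K_i-K_i^{-1}}{q_i-q_i^{-1}}$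 with $K_i=q^{d_i\check\alpha_i}$, and the quantum Serre relations. A weight is a $\mathbb{C}(q)$-algebra homomorphism $\mu_q:\mathbb{C}(q)[q^{P^\vee}]\to\mathbb{C}(q)$; the weight space is $V_{\mu_q}=\{v\in V:q^hv=\mu_q(q^h)v\ \forall h\in P^\vee\}$ and $\operatorname{wt}V=\{\mu_q:V_{\mu_q}\neq0\}$. $V$ is a highest weight module with highest weight $\lambda_q$ if it is generated by a nonzero vector of weight $\lambda_q$ killed by all $e_i$. Its integrability is $I_V=\{i\in I:\dim_{\mathbb{C}(q)}\mathbb{C}(q)[f_i]V_{\lambda_q}<\infty\}$. For $J\subset I$, $U_q(\mathfrak{l}_J)$ is the subalgebra generated by $q^{P^\vee}$ and $e_j,f_j$, $j\in J$, and $\operatorname{wt}_JV:=\operatorname{wt}U_q(\mathfrak{l}_J)V_{\lambda_q}$. For $J\subset I$, a node $j\in J$ is active if either $j\notin I_V$, or $j\in I_V$ and $\lambda_q(q^{\check\alpha_j})\neq\pm1$. $J_{\min}$ is the union of the connected components of the Dynkin diagram on $J$ containing an active node. $J_d:=\{j\in I_V:\lambda_q(q^{\check\alpha_j})=\pm1\text{ and }j\text{ is not connected (by an edge of the Dynkin diagram) to }J_{\min}\}$ and $J_{\max}:=J_{\min}\sqcup J_d$.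
   Formalization: As stated this fails for some λ_q when some d_j>1; proved for all λ_q with λ_q(K_j)=±1 replacing λ_q(q^{α̌_j})=±1 in active nodes and J_d, and as stated if, for j in I_V, λ_q(K_j)=±1 implies λ_q(q^{α̌_j})=±1. *)

theory Defs
  imports
    "HOL-Analysis.Cartesian_Space"
    "HOL-Library.Poly_Mapping"
    "HOL-Library.FuncSet"
    "HOL-Computational_Algebra.Fraction_Field"
    "HOL-Computational_Algebra.Polynomial"
    "HOL-Algebra.QuotRing"
    "HOL-Algebra.Generated_Rings"
begin

section \<open>The field of rational functions and quantum binomials\<close>

type_synonym ratfun = "complex poly fract"

definition qvar :: ratfun where
  "qvar = Fract [:0, 1:] 1"

text \<open>The quantum integer with parameter t is the balanced one, symmetric under inverting t.\<close>

definition qint :: "ratfun \<Rightarrow> nat \<Rightarrow> ratfun" where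
  "qint t n = (t ^ n - inverse t ^ n) / (t - inverse t)"

definition qfact :: "ratfun \<Rightarrow> nat \<Rightarrow> ratfun" where
  "qfact t n = (\<Prod>k = 1..n. qint t k)"

definition qbinom :: "ratfun \<Rightarrow> nat \<Rightarrow> nat \<Rightarrow> ratfun" where
  "qbinom t n k = qfact t n / (qfact t k * qfact t (n - k))"

section \<open>Monoid algebras and free algebras\<close>

text \<open>Words form a monoid under concatenation, written additively because the product on
  finitely supported functions in the theory Poly_Mapping is convolution over an additive monoid
  (which need not be commutative).\<close>

datatype 'g word = Word (letters: "'g list")

instantiation word :: (type) monoid_add
begin

definition zero_word :: "'a word" where
  "zero_word = Word []"

definition plus_word :: "'a word \<Rightarrow> 'a word \<Rightarrow> 'a word" where
  "plus_word u w = Word (letters u @ letters w)"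

instance
  by standard (auto simp: zero_word_def plus_word_def)

end

text \<open>The algebra over C(q) of a submonoid M of the ambient additive monoid.\<close>

definition monoid_algebra :: "'m::monoid_add set \<Rightarrow> ('m \<Rightarrow>\<^sub>0 ratfun) ring" where
  "monoid_algebra M =
    \<lparr>carrier = {x. Poly_Mapping.keys x \<subseteq> M}, mult = (*), one = 1, zero = 0, add = (+)\<rparr>"

definition free_algebra :: "'g set \<Rightarrow> ('g word \<Rightarrow>\<^sub>0 ratfun) ring" where
  "free_algebra X = monoid_algebra {w. set (letters w) \<subseteq> X}"

section \<open>Symmetrizable Cartan matrices and their realizations\<close>

text \<open>The index set I is the finite type 'i, the Cartan subalgebra is the type 'h with
  complex scalar multiplication \<^term>\<open>hscale\<close>. Only the values of \<^term>\<open>extra\<close> at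
  1, ..., |I| - rk A matter.\<close>

record ('i, 'h) km_datum =
  cartan :: "int ^ 'i ^ 'i"
  symm :: "'i \<Rightarrow> int"
  hscale :: "complex \<Rightarrow> 'h \<Rightarrow> 'h"
  root :: "'i \<Rightarrow> 'h \<Rightarrow> complex"
  coroot :: "'i \<Rightarrow> 'h"
  extra :: "nat \<Rightarrow> 'h"

definition gcm :: "int ^ 'i ^ 'i \<Rightarrow> bool" where
  "gcm A \<longleftrightarrow> (\<forall>i. A $ i $ i = 2) \<and> (\<forall>i j. i \<noteq> j \<longrightarrow> A $ i $ j \<le> 0) \<and>
    (\<forall>i j. A $ i $ j = 0 \<longrightarrow> A $ j $ i = 0)"

definition cartan_rank :: "int ^ 'i ^ 'i \<Rightarrow> nat" where
  "cartan_rank A = rank ((\<chi> i j. of_int (A $ i $ j)) :: complex ^ 'i ^ 'i)"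

definition extra_ix :: "('i::finite, 'h) km_datum \<Rightarrow> nat set" where
  "extra_ix D = {1..CARD('i) - cartan_rank (cartan D)}"

definition lin_comb ::
  "('i::finite, 'h::ab_group_add) km_datum \<Rightarrow> ('i \<Rightarrow> complex) \<Rightarrow> (nat \<Rightarrow> complex) \<Rightarrow> 'h" where
  "lin_comb D c b =
    (\<Sum>i\<in>UNIV. hscale D (c i) (coroot D i)) + (\<Sum>l\<in>extra_ix D. hscale D (b l) (extra D l))"

definition coweight_lattice :: "('i::finite, 'h::ab_group_add) km_datum \<Rightarrow> 'h set" where
  "coweight_lattice D =
    {lin_comb D (\<lambda>i. of_int (m i)) (\<lambda>l. of_int (n l)) |(m :: 'i \<Rightarrow> int) (n :: nat \<Rightarrow> int). True}"

text \<open>In a realization the dimension 2|I| - rk A is positive, so that the junk value 0 of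
  \<^term>\<open>vector_space.dim\<close> in infinite dimension is excluded.\<close>

definition realization :: "('i::finite, 'h::ab_group_add) km_datum \<Rightarrow> bool" where
  "realization D \<longleftrightarrow>
    vector_space (hscale D) \<and>
    vector_space.dim (hscale D) (UNIV :: 'h set) = 2 * CARD('i) - cartan_rank (cartan D) \<and>
    (\<forall>i. Vector_Spaces.linear (hscale D) (*) (root D i)) \<and>
    (\<forall>c. (\<forall>h. (\<Sum>i\<in>UNIV. c i * root D i h) = 0) \<longrightarrow> (\<forall>i. c i = 0)) \<and>
    (\<forall>c. (\<Sum>i\<in>UNIV. hscale D (c i) (coroot D i)) = 0 \<longrightarrow> (\<forall>i. c i = 0)) \<and>
    (\<forall>i j. root D j (coroot D i) = of_int (cartan D $ i $ j))"

text \<open>That the lattice has the coroots and the extra vectors as a basis over the integers and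
  tensored with C becomes the Cartan subalgebra says that these vectors form a basis over C.\<close>

definition symmetrizable_km :: "('i::finite, 'h::ab_group_add) km_datum \<Rightarrow> bool" where
  "symmetrizable_km D \<longleftrightarrow>
    gcm (cartan D) \<and>
    (\<forall>i. symm D i > 0) \<and>
    (\<forall>i j. symm D i * cartan D $ i $ j = symm D j * cartan D $ j $ i) \<and>
    realization D \<and>
    (\<forall>c b. lin_comb D c b = 0 \<longrightarrow> (\<forall>i. c i = 0) \<and> (\<forall>l\<in>extra_ix D. b l = 0)) \<and>
    (\<forall>h. \<exists>c b. h = lin_comb D c b) \<and>
    (\<forall>i. \<forall>l\<in>extra_ix D. root D i (extra D l) \<in> \<int>)"

section \<open>The quantum group\<close>

datatype ('i, 'h) gen = Gen_e 'i | Gen_f 'i | Gen_q 'h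

definition generators :: "('i::finite, 'h::ab_group_add) km_datum \<Rightarrow> ('i, 'h) gen set" where
  "generators D = range Gen_e \<union> range Gen_f \<union> Gen_q ` coweight_lattice D"

type_synonym ('i, 'h) free_elt = "('i, 'h) gen word \<Rightarrow>\<^sub>0 ratfun"

definition letter :: "('i, 'h) gen \<Rightarrow> ('i, 'h) free_elt" where
  "letter g = Poly_Mapping.single (Word [g]) 1"

definition scalar :: "ratfun \<Rightarrow> ('i, 'h) free_elt" where
  "scalar c = Poly_Mapping.single 0 c"

definition qi :: "('i::finite, 'h) km_datum \<Rightarrow> 'i \<Rightarrow> ratfun" where
  "qi D i = qvar powi symm D i"

text \<open>The exponent of the group-like element K_i.\<close>

definition kexp :: "('i::finite, 'h) km_datum \<Rightarrow> 'i \<Rightarrow> 'h" where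
  "kexp D i = hscale D (of_int (symm D i)) (coroot D i)"

definition serre ::
  "('i::finite, 'h::ab_group_add) km_datum \<Rightarrow> ('i \<Rightarrow> ('i, 'h) gen) \<Rightarrow> 'i \<Rightarrow> 'i \<Rightarrow> ('i, 'h) free_elt"
where
  "serre D g i j =
    (let n = nat (1 - cartan D $ i $ j) in
     \<Sum>r\<le>n. scalar ((- 1) ^ r * qbinom (qi D i) n r) *
        letter (g i) ^ (n - r) * letter (g j) * letter (g i) ^ r)"

definition relators :: "('i::finite, 'h::ab_group_add) km_datum \<Rightarrow> ('i, 'h) free_elt set" where
  "relators D =
    {letter (Gen_q 0) - 1} \<union>
    {letter (Gen_q h) * letter (Gen_q h') - letter (Gen_q (h + h')) |h h'.
      h \<in> coweight_lattice D \<and> h' \<in> coweight_lattice D} \<union>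
    {letter (Gen_q h) * letter (Gen_e i) * letter (Gen_q (- h)) - scalar (qvar powi n) * letter (Gen_e i) |h i n.
      h \<in> coweight_lattice D \<and> root D i h = of_int n} \<union>
    {letter (Gen_q h) * letter (Gen_f i) * letter (Gen_q (- h)) - scalar (qvar powi (- n)) * letter (Gen_f i) |h i n.
      h \<in> coweight_lattice D \<and> root D i h = of_int n} \<union>
    {letter (Gen_e i) * letter (Gen_f j) - letter (Gen_f j) * letter (Gen_e i) -
      (if i = j
       then scalar (1 / (qi D i - inverse (qi D i))) *
         (letter (Gen_q (kexp D i)) - letter (Gen_q (- kexp D i)))
       else 0) |i j. True} \<union>
    {serre D Gen_e i j |i j. i \<noteq> j} \<union>
    {serre D Gen_f i j |i j. i \<noteq> j}"

definition uq_ideal :: "('i::finite, 'h::ab_group_add) km_datum \<Rightarrow> ('i, 'h) free_elt set" where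
  "uq_ideal D = genideal (free_algebra (generators D)) (relators D)"

definition Uq :: "('i::finite, 'h::ab_group_add) km_datum \<Rightarrow> ('i, 'h) free_elt set ring" where
  "Uq D = free_algebra (generators D) Quot uq_ideal D"

definition uq_class ::
  "('i::finite, 'h::ab_group_add) km_datum \<Rightarrow> ('i, 'h) free_elt \<Rightarrow> ('i, 'h) free_elt set" where
  "uq_class D x = uq_ideal D +>\<^bsub>free_algebra (generators D)\<^esub> x"

definition uq_scalar ::
  "('i::finite, 'h::ab_group_add) km_datum \<Rightarrow> ratfun \<Rightarrow> ('i, 'h) free_elt set" where
  "uq_scalar D c = uq_class D (scalar c)"

definition uq_gen ::
  "('i::finite, 'h::ab_group_add) km_datum \<Rightarrow> ('i, 'h) gen \<Rightarrow> ('i, 'h) free_elt set" where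
  "uq_gen D g = uq_class D (letter g)"

text \<open>The subalgebra generated by S is the subring generated by S and the scalars.\<close>

definition subalgebra_gen ::
  "('i::finite, 'h::ab_group_add) km_datum \<Rightarrow> ('i, 'h) gen set \<Rightarrow> ('i, 'h) free_elt set set" where
  "subalgebra_gen D S = generate_ring (Uq D) (range (uq_scalar D) \<union> uq_gen D ` S)"

definition Uq_levi ::
  "('i::finite, 'h::ab_group_add) km_datum \<Rightarrow> 'i set \<Rightarrow> ('i, 'h) free_elt set set" where
  "Uq_levi D J =
    subalgebra_gen D (Gen_q ` coweight_lattice D \<union> Gen_e ` J \<union> Gen_f ` J)"

section \<open>Modules and weights\<close>

definition uq_module ::
  "('i::finite, 'h::ab_group_add) km_datum \<Rightarrow> (ratfun \<Rightarrow> 'v::ab_group_add \<Rightarrow> 'v) \<Rightarrow>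
    (('i, 'h) free_elt set \<Rightarrow> 'v \<Rightarrow> 'v) \<Rightarrow> bool" where
  "uq_module D vscale act \<longleftrightarrow>
    vector_space vscale \<and>
    (\<forall>x\<in>carrier (Uq D). \<forall>v w. act x (v + w) = act x v + act x w) \<and>
    (\<forall>x\<in>carrier (Uq D). \<forall>y\<in>carrier (Uq D). \<forall>v. act (x \<oplus>\<^bsub>Uq D\<^esub> y) v = act x v + act y v) \<and>
    (\<forall>x\<in>carrier (Uq D). \<forall>y\<in>carrier (Uq D). \<forall>v. act (x \<otimes>\<^bsub>Uq D\<^esub> y) v = act x (act y v)) \<and>
    (\<forall>v. act \<one>\<^bsub>Uq D\<^esub> v = v) \<and>
    (\<forall>c v. act (uq_scalar D c) v = vscale c v)"

text \<open>A weight is an algebra homomorphism from the group algebra of the lattice to C(q). Outside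
  the group algebra it takes the value \<^term>\<open>undefined\<close>, so that equality of weights is equality
  of functions.\<close>

type_synonym 'h weight = "('h \<Rightarrow>\<^sub>0 ratfun) \<Rightarrow> ratfun"

definition weights :: "('i::finite, 'h::ab_group_add) km_datum \<Rightarrow> 'h weight set" where
  "weights D =
    (let G = carrier (monoid_algebra (coweight_lattice D)) in
     {\<mu> \<in> extensional G.
       (\<forall>x\<in>G. \<forall>y\<in>G. \<mu> (x + y) = \<mu> x + \<mu> y \<and> \<mu> (x * y) = \<mu> x * \<mu> y) \<and>
       (\<forall>c. \<mu> (Poly_Mapping.single 0 c) = c)})"

definition weight_at :: "'h weight \<Rightarrow> 'h \<Rightarrow> ratfun" where
  "weight_at \<mu> h = \<mu> (Poly_Mapping.single h 1)"

definition weight_space ::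
  "('i::finite, 'h::ab_group_add) km_datum \<Rightarrow> (ratfun \<Rightarrow> 'v::ab_group_add \<Rightarrow> 'v) \<Rightarrow>
    (('i, 'h) free_elt set \<Rightarrow> 'v \<Rightarrow> 'v) \<Rightarrow> 'h weight \<Rightarrow> 'v set" where
  "weight_space D vscale act \<mu> =
    {v. \<forall>h\<in>coweight_lattice D. act (uq_gen D (Gen_q h)) v = vscale (weight_at \<mu> h) v}"

text \<open>The weights occurring in a subspace W of V.\<close>

definition wt ::
  "('i::finite, 'h::ab_group_add) km_datum \<Rightarrow> (ratfun \<Rightarrow> 'v::ab_group_add \<Rightarrow> 'v) \<Rightarrow>
    (('i, 'h) free_elt set \<Rightarrow> 'v \<Rightarrow> 'v) \<Rightarrow> 'v set \<Rightarrow> 'h weight set" where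
  "wt D vscale act W = {\<mu> \<in> weights D. W \<inter> weight_space D vscale act \<mu> - {0} \<noteq> {}}"

definition act_span ::
  "(ratfun \<Rightarrow> 'v::ab_group_add \<Rightarrow> 'v) \<Rightarrow> ('u \<Rightarrow> 'v \<Rightarrow> 'v) \<Rightarrow> 'u set \<Rightarrow> 'v set \<Rightarrow> 'v set" where
  "act_span vscale act B W = module.span vscale {act u w |u w. u \<in> B \<and> w \<in> W}"

definition highest_weight_module ::
  "('i::finite, 'h::ab_group_add) km_datum \<Rightarrow> (ratfun \<Rightarrow> 'v::ab_group_add \<Rightarrow> 'v) \<Rightarrow>
    (('i, 'h) free_elt set \<Rightarrow> 'v \<Rightarrow> 'v) \<Rightarrow> 'h weight \<Rightarrow> bool" where
  "highest_weight_module D vscale act lam \<longleftrightarrow>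
    uq_module D vscale act \<and> lam \<in> weights D \<and>
    (\<exists>v. v \<noteq> 0 \<and> v \<in> weight_space D vscale act lam \<and>
      (\<forall>i. act (uq_gen D (Gen_e i)) v = 0) \<and>
      (\<forall>w. \<exists>x\<in>carrier (Uq D). w = act x v))"

definition integrability ::
  "('i::finite, 'h::ab_group_add) km_datum \<Rightarrow> (ratfun \<Rightarrow> 'v::ab_group_add \<Rightarrow> 'v) \<Rightarrow>
    (('i, 'h) free_elt set \<Rightarrow> 'v \<Rightarrow> 'v) \<Rightarrow> 'h weight \<Rightarrow> 'i set" where
  "integrability D vscale act lam =
    {i. \<exists>B. finite B \<and>
      module.span vscale B =
        act_span vscale act (subalgebra_gen D {Gen_f i}) (weight_space D vscale act lam)}"

definition wt_levi ::
  "('i::finite, 'h::ab_group_add) km_datum \<Rightarrow> (ratfun \<Rightarrow> 'v::ab_group_add \<Rightarrow> 'v) \<Rightarrow>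
    (('i, 'h) free_elt set \<Rightarrow> 'v \<Rightarrow> 'v) \<Rightarrow> 'h weight \<Rightarrow> 'i set \<Rightarrow> 'h weight set" where
  "wt_levi D vscale act lam J =
    wt D vscale act (act_span vscale act (Uq_levi D J) (weight_space D vscale act lam))"

section \<open>Active nodes\<close>

definition dynkin_edge :: "int ^ 'i ^ 'i \<Rightarrow> 'i \<Rightarrow> 'i \<Rightarrow> bool" where
  "dynkin_edge A i j \<longleftrightarrow> i \<noteq> j \<and> A $ i $ j \<noteq> 0"

definition dynkin_components :: "int ^ 'i ^ 'i \<Rightarrow> 'i set \<Rightarrow> 'i set set" where
  "dynkin_components A J =
    J // ({(i, j). i \<in> J \<and> j \<in> J \<and> dynkin_edge A i j}\<^sup>* \<inter> J \<times> J)"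

text \<open>The argument \<^term>\<open>t\<close> is the family of lattice elements at which the highest weight is
  tested for being plus or minus 1. For the coroots \<^term>\<open>t = coroot D\<close> this is the condition that
  the highest weight takes the value plus or minus 1 at q to the power of the coroot of j.
  For \<^term>\<open>t = kexp D\<close> it is the condition that it does so at K_j. For an integrable node j the two differ only
  when d_j > 1 and the value at the coroot is a root of unity other than plus or minus 1 whose
  d_j-th power is plus or minus 1. Then f_j acts by 0 on the highest weight space, although j is
  active for the first choice of \<^term>\<open>t\<close>.\<close>

definition active ::
  "('i::finite, 'h::ab_group_add) km_datum \<Rightarrow> (ratfun \<Rightarrow> 'v::ab_group_add \<Rightarrow> 'v) \<Rightarrow>
    (('i, 'h) free_elt set \<Rightarrow> 'v \<Rightarrow> 'v) \<Rightarrow> 'h weight \<Rightarrow> ('i \<Rightarrow> 'h) \<Rightarrow> 'i \<Rightarrow> bool" where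
  "active D vscale act lam t j \<longleftrightarrow>
    j \<notin> integrability D vscale act lam \<or>
    (j \<in> integrability D vscale act lam \<and> weight_at lam (t j) \<notin> {1, - 1})"

definition J_min ::
  "('i::finite, 'h::ab_group_add) km_datum \<Rightarrow> (ratfun \<Rightarrow> 'v::ab_group_add \<Rightarrow> 'v) \<Rightarrow>
    (('i, 'h) free_elt set \<Rightarrow> 'v \<Rightarrow> 'v) \<Rightarrow> 'h weight \<Rightarrow> ('i \<Rightarrow> 'h) \<Rightarrow> 'i set \<Rightarrow> 'i set" where
  "J_min D vscale act lam t J =
    \<Union> {C \<in> dynkin_components (cartan D) J. \<exists>j\<in>C. active D vscale act lam t j}"

definition J_d ::
  "('i::finite, 'h::ab_group_add) km_datum \<Rightarrow> (ratfun \<Rightarrow> 'v::ab_group_add \<Rightarrow> 'v) \<Rightarrow>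
    (('i, 'h) free_elt set \<Rightarrow> 'v \<Rightarrow> 'v) \<Rightarrow> 'h weight \<Rightarrow> ('i \<Rightarrow> 'h) \<Rightarrow> 'i set \<Rightarrow> 'i set" where
  "J_d D vscale act lam t J =
    {j \<in> integrability D vscale act lam. weight_at lam (t j) \<in> {1, - 1} \<and>
      (\<forall>k\<in>J_min D vscale act lam t J. \<not> dynkin_edge (cartan D) j k)}"

definition J_max ::
  "('i::finite, 'h::ab_group_add) km_datum \<Rightarrow> (ratfun \<Rightarrow> 'v::ab_group_add \<Rightarrow> 'v) \<Rightarrow>
    (('i, 'h) free_elt set \<Rightarrow> 'v \<Rightarrow> 'v) \<Rightarrow> 'h weight \<Rightarrow> ('i \<Rightarrow> 'h) \<Rightarrow> 'i set \<Rightarrow> 'i set" where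
  "J_max D vscale act lam t J = J_min D vscale act lam t J \<union> J_d D vscale act lam t J"

end

theory Submission
  imports Defs
begin

text \<open>
  Let \<open>v\<close> be a highest weight vector. For a word \<open>w = i\<^sub>1 \<dots> i\<^sub>n\<close> write \<open>f\<^sub>w v\<close> for
  \<open>f\<^bsub>i\<^sub>1\<^esub> \<cdots> f\<^bsub>i\<^sub>n\<^esub> v\<close>. The span of the vectors \<open>f\<^sub>w v\<close>, with \<open>w\<close> a word over \<open>J\<close>, is stable
  under the Levi subalgebra of \<open>J\<close>, so it is the Levi module; the whole module is the case
  \<open>J = I\<close>, and its highest weight space is the line through \<open>v\<close>. Since weight vectors of different
  weights are independent (\<open>weight_vector_in_span\<close>), the weights of the Levi module are exactly the
  weights of the nonzero vectors \<open>f\<^sub>w v\<close> with \<open>w\<close> over \<open>J\<close>.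

  The simple roots are independent and \<open>q\<close> is not a root of unity, so the weight of \<open>f\<^sub>w v\<close> determines how
  often each letter occurs in \<open>w\<close> (\<open>wordwt_inject\<close>), in particular the set of letters of \<open>w\<close>.
  Hence an inclusion between the weights for \<open>J\<close> and for \<open>J'\<close> only says that every letter of a
  word \<open>w\<close> over \<open>J\<close> with \<open>f\<^sub>w v \<noteq> 0\<close> lies in \<open>J'\<close> (\<open>wt_levi_subset_iff\<close>). It remains to
  identify the set \<open>levi_support J\<close> of these letters with the union of the active components.

  A node \<open>i\<close> is active, with the highest weight tested at \<open>K\<^sub>i\<close>, if and only if \<open>f\<^sub>i v \<noteq> 0\<close>
  (\<open>active_kexp_iff\<close>). This is the representation theory of quantum sl(2): an integrable node has
  some power of \<open>f\<^sub>i\<close> killing \<open>v\<close>, and if \<open>K\<^sub>i\<close> acts on \<open>v\<close> by \<open>\<plusminus>1\<close> this is only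
  possible for the first power. Now let \<open>w\<close> be a word over \<open>J\<close> with a letter outside the active
  components. The last such letter commutes with all letters behind it, hence reaches \<open>v\<close> and kills it
  (\<open>fword_nonzero_hull\<close>). Conversely, suppose that \<open>f\<^sub>w v \<noteq> 0\<close> and that an inactive node \<open>k\<close>
  which is not a letter of \<open>w\<close> is joined to a letter of \<open>w\<close>. Then \<open>e\<^sub>k\<close> kills \<open>f\<^sub>w v\<close>, and \<open>K\<^sub>k\<close> acts on it by
  \<open>\<plusminus>q\<^sup>m\<close> with \<open>m > 0\<close>, so \<open>e\<^sub>k f\<^sub>k f\<^sub>w v\<close> is a nonzero multiple of \<open>f\<^sub>w v\<close>, and
  \<open>f\<^sub>k f\<^sub>w v \<noteq> 0\<close> (\<open>F_fword_nonzero\<close>). Starting from the active nodes, this reaches every node of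
  their components.

  The criterion for equality follows by applying the criterion for inclusion in both directions,
  together with a statement about graphs (\<open>active_hull_subset_iff\<close>). Finally, testing the highest
  weight at the coroots gives the same active nodes under the hypothesis made for that version,
  because \<open>K\<^sub>i\<close> is the \<open>d\<^sub>i\<close>-th power of \<open>q\<close> to the coroot.
\<close>

section \<open>The indeterminate q\<close>

lemma qvar_power: "qvar ^ n = Fract (Polynomial.monom 1 n) 1"
  by (induction n) (simp_all add: qvar_def One_fract_def monom_0 monom_Suc mult.commute one_pCons)

lemma qvar_nonzero [simp]: "qvar \<noteq> 0"
  by (simp add: qvar_def Zero_fract_def eq_fract)

lemma qvar_power_eq_1: "qvar ^ n = 1 \<Longrightarrow> n = 0"
proof -
  assume "qvar ^ n = 1"
  then have "Polynomial.monom (1::complex) n = 1"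
    by (simp add: qvar_power One_fract_def eq_fract)
  then show "n = 0"
    by (metis degree_1 degree_monom_eq one_neq_zero)
qed

lemma qvar_powi_eq_1_iff [simp]: "qvar powi n = 1 \<longleftrightarrow> n = 0"
proof
  assume *: "qvar powi n = 1"
  show "n = 0"
  proof (cases "n \<ge> 0")
    case True
    then show ?thesis using * qvar_power_eq_1[of "nat n"] by (simp add: power_int_def)
  next
    case False
    then have "qvar ^ nat (- n) = 1"
      using * by (simp add: power_int_def power_inverse)
    from qvar_power_eq_1[OF this] show ?thesis using False by simp
  qed
qed simp

lemma qvar_powi_inject [simp]: "qvar powi m = qvar powi n \<longleftrightarrow> m = n"
proof
  assume "qvar powi m = qvar powi n"
  then have "qvar powi (m - n) = 1" by (simp add: power_int_diff)
  then show "m = n" by simp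
qed simp

section \<open>The coweight lattice\<close>

text \<open>On the coweight lattice, where the roots take integer values, this is the value of the root.\<close>

definition root_int :: "('i::finite, 'h) km_datum \<Rightarrow> 'i \<Rightarrow> 'h \<Rightarrow> int" where
  "root_int D i h = \<lfloor>Re (root D i h)\<rfloor>"

locale symmetrizable_datum =
  fixes D :: "('i::finite, 'h::ab_group_add) km_datum"
  assumes symmetrizable: "symmetrizable_km D"
begin

abbreviation "coweights \<equiv> coweight_lattice D"

sublocale H: vector_space "hscale D"
  using symmetrizable by (simp add: symmetrizable_km_def realization_def)

lemma root_hom: "module_hom (hscale D) (*) (root D i)"
  using symmetrizable by (simp add: symmetrizable_km_def realization_def module_hom_iff_linear)

lemma root_add: "root D i (x + y) = root D i x + root D i y"
  by (rule module_hom.add[OF root_hom])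

lemma root_scale: "root D i (hscale D c x) = c * root D i x"
  by (rule module_hom.scale[OF root_hom])

lemma root_sum: "root D i (\<Sum>x\<in>A. g x) = (\<Sum>x\<in>A. root D i (g x))"
  by (rule module_hom.sum[OF root_hom])

lemma root_coroot: "root D j (coroot D i) = of_int (cartan D $ i $ j)"
  using symmetrizable by (simp add: symmetrizable_km_def realization_def)

lemma root_extra: "l \<in> extra_ix D \<Longrightarrow> root D i (extra D l) \<in> \<int>"
  using symmetrizable by (simp add: symmetrizable_km_def)

lemma symm_pos: "symm D i > 0"
  using symmetrizable by (simp add: symmetrizable_km_def)

lemma cartan_diag: "cartan D $ i $ i = 2"
  using symmetrizable by (simp add: symmetrizable_km_def gcm_def)

lemma cartan_nonpos: "i \<noteq> j \<Longrightarrow> cartan D $ i $ j \<le> 0"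
  using symmetrizable by (simp add: symmetrizable_km_def gcm_def)

lemma cartan_eq_0_sym: "cartan D $ i $ j = 0 \<Longrightarrow> cartan D $ j $ i = 0"
  using symmetrizable by (simp add: symmetrizable_km_def gcm_def)

lemma lin_comb_add:
  "lin_comb D c b + lin_comb D c' b' = lin_comb D (\<lambda>i. c i + c' i) (\<lambda>l. b l + b' l)"
  by (simp add: lin_comb_def H.scale_left_distrib sum.distrib)

lemma lin_comb_uminus: "- lin_comb D c b = lin_comb D (\<lambda>i. - c i) (\<lambda>l. - b l)"
  by (simp add: lin_comb_def sum_negf)

lemma lattice_memI: "lin_comb D (\<lambda>i. of_int (m i)) (\<lambda>l. of_int (n l)) \<in> coweights"
  by (auto simp: coweight_lattice_def)

lemma lattice_zero: "0 \<in> coweights"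
  using lattice_memI[of "\<lambda>_. 0" "\<lambda>_. 0"] by (simp add: lin_comb_def)

lemma lattice_add: "h \<in> coweights \<Longrightarrow> h' \<in> coweights \<Longrightarrow> h + h' \<in> coweights"
  unfolding coweight_lattice_def
  by (force simp: lin_comb_add simp flip: of_int_add)

lemma lattice_uminus: "h \<in> coweights \<Longrightarrow> - h \<in> coweights"
  unfolding coweight_lattice_def
  by (force simp: lin_comb_uminus simp flip: of_int_minus)

lemma lattice_coroot_multiple: "hscale D (of_int m) (coroot D i) \<in> coweights"
proof -
  have "hscale D (of_int (if j = i then m else 0)) (coroot D j)
      = (if j = i then hscale D (of_int m) (coroot D j) else 0)" for j
    by simp
  then have "lin_comb D (\<lambda>j. of_int (if j = i then m else 0)) (\<lambda>l. of_int 0)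
      = hscale D (of_int m) (coroot D i)"
    by (simp add: lin_comb_def)
  then show ?thesis
    using lattice_memI[of "\<lambda>j. if j = i then m else 0" "\<lambda>_. 0"] by simp
qed

lemma lattice_coroot: "coroot D i \<in> coweights"
  using lattice_coroot_multiple[of 1 i] by simp

lemma lattice_kexp: "kexp D i \<in> coweights"
  by (simp add: kexp_def lattice_coroot_multiple)

lemma lattice_extra:
  assumes "l \<in> extra_ix D"
  shows "extra D l \<in> coweights"
proof -
  have fin: "finite (extra_ix D)" by (simp add: extra_ix_def)
  have "lin_comb D (\<lambda>j. of_int 0) (\<lambda>k. of_int (if k = l then 1 else 0))
      = (\<Sum>k\<in>extra_ix D. if k = l then extra D k else 0)"
    by (simp add: lin_comb_def) (rule sum.cong, auto)
  also have "\<dots> = extra D l" using assms fin by simp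
  finally show ?thesis
    using lattice_memI[of "\<lambda>_. 0" "\<lambda>k. if k = l then 1 else 0"] by simp
qed

lemma root_lin_comb:
  "root D i (lin_comb D c b) =
    (\<Sum>j\<in>UNIV. c j * root D i (coroot D j)) + (\<Sum>l\<in>extra_ix D. b l * root D i (extra D l))"
  by (simp add: lin_comb_def root_add root_sum root_scale)

lemma root_eq_root_int: "h \<in> coweights \<Longrightarrow> root D i h = of_int (root_int D i h)"
proof -
  assume "h \<in> coweights"
  then obtain m :: "'i \<Rightarrow> int" and n :: "nat \<Rightarrow> int"
    where h: "h = lin_comb D (\<lambda>i. of_int (m i)) (\<lambda>l. of_int (n l))"
    by (auto simp: coweight_lattice_def)
  have "root D i h \<in> \<int>"
    unfolding h root_lin_comb root_coroot
    by (intro Ints_add Ints_sum Ints_mult Ints_of_int root_extra)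
  then show ?thesis by (auto simp: root_int_def elim!: Ints_cases)
qed

lemma root_int_add:
  "h \<in> coweights \<Longrightarrow> h' \<in> coweights \<Longrightarrow> root_int D i (h + h') = root_int D i h + root_int D i h'"
proof -
  assume "h \<in> coweights" "h' \<in> coweights"
  then have "(of_int (root_int D i (h + h')) :: complex) = of_int (root_int D i h + root_int D i h')"
    by (simp add: lattice_add root_add flip: root_eq_root_int)
  then show ?thesis by (simp only: of_int_eq_iff)
qed

lemma root_int_kexp: "root_int D j (kexp D i) = symm D i * cartan D $ i $ j"
  by (simp add: root_int_def root_coroot kexp_def root_scale flip: of_int_mult)

text \<open>Linear independence of the simple roots is a statement about the whole Cartan subalgebra;
  it survives restriction to the lattice because the lattice contains a basis.\<close>

lemma root_int_independent:
  fixes m :: "'i \<Rightarrow> int"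
  assumes "\<And>h. h \<in> coweights \<Longrightarrow> (\<Sum>i\<in>UNIV. m i * root_int D i h) = 0"
  shows "m i = 0"
proof -
  have on_lattice: "(\<Sum>i\<in>UNIV. of_int (m i) * root D i h) = 0" if "h \<in> coweights" for h
  proof -
    have "(\<Sum>i\<in>UNIV. of_int (m i) * root D i h) = of_int (\<Sum>i\<in>UNIV. m i * root_int D i h)"
      using that by (simp add: root_eq_root_int)
    then show ?thesis using assms[OF that] by simp
  qed
  have "(\<Sum>i\<in>UNIV. of_int (m i) * root D i h) = 0" for h
  proof -
    obtain c b where h: "h = lin_comb D c b"
      using symmetrizable unfolding symmetrizable_km_def by blast
    have "(\<Sum>i\<in>UNIV. of_int (m i) * root D i h)
        = (\<Sum>j\<in>UNIV. c j * (\<Sum>i\<in>UNIV. of_int (m i) * root D i (coroot D j)))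
        + (\<Sum>l\<in>extra_ix D. b l * (\<Sum>i\<in>UNIV. of_int (m i) * root D i (extra D l)))"
      unfolding h root_lin_comb sum_distrib_left sum_distrib_left distrib_left sum.distrib
      by (subst (1 4) sum.swap) (simp add: mult_ac)
    also have "\<dots> = 0"
      by (simp add: on_lattice lattice_coroot lattice_extra)
    finally show ?thesis .
  qed
  moreover have "(\<forall>h. (\<Sum>i\<in>UNIV. c i * root D i h) = 0) \<longrightarrow> (\<forall>i. c i = 0)" for c
    using symmetrizable unfolding symmetrizable_km_def realization_def by blast
  from this[of "\<lambda>i. of_int (m i)"] calculation have "(of_int (m i) :: complex) = 0" by blast
  then show ?thesis by simp
qed

end

section \<open>Monoid algebras\<close>

lemma poly_mapping_eq_sum_single:
  "x = (\<Sum>k\<in>Poly_Mapping.keys x. Poly_Mapping.single k (Poly_Mapping.lookup x k))"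
proof (rule poly_mapping_eqI)
  fix k
  show "Poly_Mapping.lookup x k = Poly_Mapping.lookup (\<Sum>k\<in>Poly_Mapping.keys x. Poly_Mapping.single k (Poly_Mapping.lookup x k)) k"
    by (simp add: lookup_sum lookup_single when_def in_keys_iff)
qed

text \<open>The operations are those of the type of all finitely supported functions, where the ring axioms
  hold; that \<open>M\<close> is a submonoid makes the carrier closed under them.\<close>

lemma ring_monoid_algebra:
  fixes M :: "'m::monoid_add set"
  assumes "0 \<in> M" and "\<And>x y. x \<in> M \<Longrightarrow> y \<in> M \<Longrightarrow> x + y \<in> M"
  shows "ring (monoid_algebra M)"
proof (rule ringI)
  show "abelian_group (monoid_algebra M)"
  proof (rule abelian_groupI)
    fix x assume "x \<in> carrier (monoid_algebra M)"
    then show "\<exists>y\<in>carrier (monoid_algebra M). y \<oplus>\<^bsub>monoid_algebra M\<^esub> x = \<zero>\<^bsub>monoid_algebra M\<^esub>"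
      by (intro bexI[of _ "- x"]) (auto simp: monoid_algebra_def in_keys_iff)
  qed (use keys_add in \<open>fastforce simp: monoid_algebra_def add_ac\<close>)+
  show "Group.monoid (monoid_algebra M)"
  proof (rule monoidI)
    fix x y assume "x \<in> carrier (monoid_algebra M)" "y \<in> carrier (monoid_algebra M)"
    then show "x \<otimes>\<^bsub>monoid_algebra M\<^esub> y \<in> carrier (monoid_algebra M)"
      using keys_mult[of x y] assms(2) by (fastforce simp: monoid_algebra_def)
  qed (use assms in \<open>auto simp: monoid_algebra_def mult.assoc\<close>)
qed (auto simp: monoid_algebra_def algebra_simps)

lemma ring_free_algebra: "ring (free_algebra X)"
  unfolding free_algebra_def
  by (rule ring_monoid_algebra) (auto simp: zero_word_def plus_word_def)

lemma free_algebra_simps [simp]: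
  "x \<oplus>\<^bsub>free_algebra X\<^esub> y = x + y"
  "x \<otimes>\<^bsub>free_algebra X\<^esub> y = x * y"
  "\<one>\<^bsub>free_algebra X\<^esub> = 1"
  "\<zero>\<^bsub>free_algebra X\<^esub> = 0"
  by (simp_all add: free_algebra_def monoid_algebra_def)

lemma free_algebra_carrier:
  "x \<in> carrier (free_algebra X) \<longleftrightarrow> (\<forall>w\<in>Poly_Mapping.keys x. set (letters w) \<subseteq> X)"
  by (auto simp: free_algebra_def monoid_algebra_def)

lemma free_algebra_one: "1 \<in> carrier (free_algebra X)"
  and free_algebra_zero: "0 \<in> carrier (free_algebra X)"
  by (simp_all add: free_algebra_carrier zero_word_def)

lemma free_algebra_scalar: "scalar c \<in> carrier (free_algebra X)"
  and free_algebra_letter: "g \<in> X \<Longrightarrow> letter g \<in> carrier (free_algebra X)"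
  by (auto simp: free_algebra_carrier scalar_def letter_def zero_word_def split: if_splits)

lemma free_algebra_mult:
  "x \<in> carrier (free_algebra X) \<Longrightarrow> y \<in> carrier (free_algebra X) \<Longrightarrow> x * y \<in> carrier (free_algebra X)"
  using ring.ring_simprules(5)[OF ring_free_algebra, of x X y] by simp

lemma free_algebra_add:
  "x \<in> carrier (free_algebra X) \<Longrightarrow> y \<in> carrier (free_algebra X) \<Longrightarrow> x + y \<in> carrier (free_algebra X)"
  using ring.ring_simprules(1)[OF ring_free_algebra, of x X y] by simp

lemma free_algebra_diff:
  "x \<in> carrier (free_algebra X) \<Longrightarrow> y \<in> carrier (free_algebra X) \<Longrightarrow> x - y \<in> carrier (free_algebra X)"
  using keys_diff[of x y] by (fastforce simp: free_algebra_carrier)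

lemma free_algebra_power: "x \<in> carrier (free_algebra X) \<Longrightarrow> x ^ n \<in> carrier (free_algebra X)"
  by (induction n) (simp_all add: free_algebra_mult free_algebra_one)

lemma free_algebra_sum:
  "(\<And>k. k \<in> A \<Longrightarrow> f k \<in> carrier (free_algebra X)) \<Longrightarrow> sum f A \<in> carrier (free_algebra X)"
  by (induction A rule: infinite_finite_induct) (simp_all add: free_algebra_add free_algebra_zero)

lemmas free_algebra_closed =
  free_algebra_one free_algebra_zero free_algebra_scalar free_algebra_letter free_algebra_mult
  free_algebra_add free_algebra_diff free_algebra_power free_algebra_sum

text \<open>Scalars are supported on the empty word, so they are central.\<close>

lemma scalar_commutes_letter: "scalar c * letter g = letter g * scalar c"
  by (simp add: scalar_def letter_def mult_single)

lemma single_Cons: "Poly_Mapping.single (Word (g # gs)) c = letter g * Poly_Mapping.single (Word gs) c"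
  by (simp add: letter_def mult_single plus_word_def)

section \<open>The quantum group as a quotient of the free algebra\<close>

context symmetrizable_datum
begin

abbreviation "free \<equiv> free_algebra (generators D)"

lemma gen_e: "Gen_e i \<in> generators D"
  and gen_f: "Gen_f i \<in> generators D"
  and gen_q: "h \<in> coweights \<Longrightarrow> Gen_q h \<in> generators D"
  by (auto simp: generators_def)

lemma relators_subset: "relators D \<subseteq> carrier free"
  unfolding relators_def serre_def Let_def
  by (auto intro!: free_algebra_closed gen_e gen_f gen_q lattice_zero lattice_add lattice_uminus
      lattice_kexp)

lemma ideal_uq_ideal: "ideal (uq_ideal D) free"
  unfolding uq_ideal_def by (rule ring.genideal_ideal[OF ring_free_algebra relators_subset])

lemma relators_in_ideal: "relators D \<subseteq> uq_ideal D"
  unfolding uq_ideal_def by (rule ring.genideal_self[OF ring_free_algebra relators_subset])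

lemma ring_Uq: "ring (Uq D)"
  unfolding Uq_def by (rule ideal.quotient_is_ring[OF ideal_uq_ideal])

lemma uq_class_hom: "uq_class D \<in> ring_hom free (Uq D)"
  using ideal.rcos_ring_hom[OF ideal_uq_ideal] by (simp add: uq_class_def[abs_def] Uq_def)

lemma uq_class_closed: "x \<in> carrier free \<Longrightarrow> uq_class D x \<in> carrier (Uq D)"
  by (rule ring_hom_closed[OF uq_class_hom])

lemma uq_class_add:
  "x \<in> carrier free \<Longrightarrow> y \<in> carrier free \<Longrightarrow>
    uq_class D (x + y) = uq_class D x \<oplus>\<^bsub>Uq D\<^esub> uq_class D y"
  using ring_hom_add[OF uq_class_hom, of x y] by simp

lemma uq_class_mult:
  "x \<in> carrier free \<Longrightarrow> y \<in> carrier free \<Longrightarrow>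
    uq_class D (x * y) = uq_class D x \<otimes>\<^bsub>Uq D\<^esub> uq_class D y"
  using ring_hom_mult[OF uq_class_hom, of x y] by simp

lemma uq_class_one: "uq_class D 1 = \<one>\<^bsub>Uq D\<^esub>"
  using ring_hom_one[OF uq_class_hom] by simp

lemma uq_class_ideal:
  assumes "x \<in> uq_ideal D"
  shows "uq_class D x = \<zero>\<^bsub>Uq D\<^esub>"
proof -
  interpret I: ideal "uq_ideal D" free by (rule ideal_uq_ideal)
  show ?thesis using I.a_rcos_const[OF assms] by (simp add: uq_class_def Uq_def FactRing_def)
qed

lemma Uq_carrierE:
  assumes "u \<in> carrier (Uq D)"
  obtains x where "x \<in> carrier free" "u = uq_class D x"
  using assms by (auto simp: Uq_def FactRing_def A_RCOSETS_def' uq_class_def)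

lemma subalgebra_gens_closed:
  "S \<subseteq> generators D \<Longrightarrow> range (uq_scalar D) \<union> uq_gen D ` S \<subseteq> carrier (Uq D)"
  by (auto simp: uq_scalar_def uq_gen_def intro!: uq_class_closed free_algebra_closed)

end

section \<open>Operators of a module\<close>

locale uq_representation = symmetrizable_datum D + vector_space vscale
  for D :: "('i::finite, 'h::ab_group_add) km_datum"
    and vscale :: "ratfun \<Rightarrow> 'v::ab_group_add \<Rightarrow> 'v" +
  fixes act :: "('i, 'h) free_elt set \<Rightarrow> 'v \<Rightarrow> 'v"
  assumes uq_mod: "uq_module D vscale act"
begin

text \<open>Working with the action of elements of the free algebra avoids the coset arithmetic of the
  quotient: the defining relations become equations between operators.\<close>

definition rep :: "('i, 'h) free_elt \<Rightarrow> 'v \<Rightarrow> 'v" where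
  "rep x v = act (uq_class D x) v"

abbreviation E :: "'i \<Rightarrow> 'v \<Rightarrow> 'v" where "E i \<equiv> rep (letter (Gen_e i))"
abbreviation F :: "'i \<Rightarrow> 'v \<Rightarrow> 'v" where "F i \<equiv> rep (letter (Gen_f i))"
abbreviation Q :: "'h \<Rightarrow> 'v \<Rightarrow> 'v" where "Q h \<equiv> rep (letter (Gen_q h))"

lemma act_zero: "act \<zero>\<^bsub>Uq D\<^esub> v = 0"
proof -
  have "act (\<zero>\<^bsub>Uq D\<^esub> \<oplus>\<^bsub>Uq D\<^esub> \<zero>\<^bsub>Uq D\<^esub>) v = act \<zero>\<^bsub>Uq D\<^esub> v + act \<zero>\<^bsub>Uq D\<^esub> v"
    using uq_mod ring.ring_simprules(2)[OF ring_Uq] unfolding uq_module_def by blast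
  then show ?thesis using ring.ring_simprules(8)[OF ring_Uq ring.ring_simprules(2)[OF ring_Uq]] by simp
qed

lemma act_uminus: "x \<in> carrier (Uq D) \<Longrightarrow> act (\<ominus>\<^bsub>Uq D\<^esub> x) v = - act x v"
proof -
  assume x: "x \<in> carrier (Uq D)"
  then have "act (x \<oplus>\<^bsub>Uq D\<^esub> (\<ominus>\<^bsub>Uq D\<^esub> x)) v = act x v + act (\<ominus>\<^bsub>Uq D\<^esub> x) v"
    using uq_mod ring.ring_simprules(3)[OF ring_Uq] unfolding uq_module_def by blast
  then have "act x v + act (\<ominus>\<^bsub>Uq D\<^esub> x) v = 0"
    using ring.ring_simprules(16)[OF ring_Uq x] by (simp add: act_zero)
  then show ?thesis by (simp add: add_eq_0_iff)
qed

lemma rep_vec_add: "x \<in> carrier free \<Longrightarrow> rep x (v + w) = rep x v + rep x w"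
  using uq_mod by (simp add: rep_def uq_module_def uq_class_closed)

lemma rep_add:
  "x \<in> carrier free \<Longrightarrow> y \<in> carrier free \<Longrightarrow> rep (x + y) v = rep x v + rep y v"
  using uq_mod by (simp add: rep_def uq_module_def uq_class_closed uq_class_add)

lemma rep_mult:
  "x \<in> carrier free \<Longrightarrow> y \<in> carrier free \<Longrightarrow> rep (x * y) v = rep x (rep y v)"
  using uq_mod by (simp add: rep_def uq_module_def uq_class_closed uq_class_mult)

lemma rep_one: "rep 1 v = v"
  using uq_mod by (simp add: rep_def uq_module_def uq_class_one)

lemma rep_scalar: "rep (scalar c) v = vscale c v"
  using uq_mod by (simp add: rep_def uq_module_def flip: uq_scalar_def)

lemma rep_relator: "x \<in> relators D \<Longrightarrow> rep x v = 0"
  using relators_in_ideal by (auto simp: rep_def uq_class_ideal act_zero)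

lemma rep_diff:
  assumes "x \<in> carrier free" "y \<in> carrier free"
  shows "rep (x - y) v = rep x v - rep y v"
  using rep_add[of "x - y" y v] assms by (simp add: free_algebra_diff)

text \<open>Turns each defining relation into an identity of operators.\<close>

lemma rep_relator_eq:
  "x - y \<in> relators D \<Longrightarrow> x \<in> carrier free \<Longrightarrow> y \<in> carrier free \<Longrightarrow> rep x v = rep y v"
  using rep_diff[of x y v] rep_relator[of "x - y" v] by simp

lemma rep_scale:
  assumes "g \<in> generators D"
  shows "rep (letter g) (vscale c v) = vscale c (rep (letter g) v)"
  using assms rep_mult[of "letter g" "scalar c" v] rep_mult[of "scalar c" "letter g" v]
  by (simp add: free_algebra_closed rep_scalar scalar_commutes_letter)

lemma gen_module_hom: "g \<in> generators D \<Longrightarrow> module_hom vscale vscale (rep (letter g))"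
  by unfold_locales (simp_all add: rep_vec_add rep_scale free_algebra_closed)

lemmas gen_add = module_hom.add[OF gen_module_hom]
  and gen_scale = module_hom.scale[OF gen_module_hom]
  and gen_zero = module_hom.zero[OF gen_module_hom]
  and gen_sum = module_hom.sum[OF gen_module_hom]

text \<open>Generators act linearly, so it suffices to check stability of a subspace on a spanning set.\<close>

lemma gen_span:
  assumes "g \<in> generators D" "subspace W" "\<And>x. x \<in> S \<Longrightarrow> rep (letter g) x \<in> W" "x \<in> span S"
  shows "rep (letter g) x \<in> W"
  using assms(4)
  by (induction rule: span_induct_alt)
     (use assms(1-3) in \<open>simp_all add: gen_add gen_scale gen_zero subspace_0 subspace_add subspace_scale\<close>)

lemmas carriers = free_algebra_closed gen_e gen_f gen_q lattice_zero lattice_add lattice_uminus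
  lattice_kexp

lemma Q_zero: "Q 0 v = v"
  using rep_relator_eq[of "letter (Gen_q 0)" 1 v]
  by (simp add: relators_def carriers rep_one)

lemma Q_add:
  assumes "h \<in> coweights" "h' \<in> coweights"
  shows "Q (h + h') v = Q h (Q h' v)"
proof -
  have "letter (Gen_q h) * letter (Gen_q h') - letter (Gen_q (h + h')) \<in> relators D"
    using assms unfolding relators_def by blast
  from rep_relator_eq[OF this] assms show ?thesis by (simp add: carriers rep_mult)
qed

lemma Q_F:
  assumes "h \<in> coweights"
  shows "Q h (F i v) = vscale (qvar powi (- root_int D i h)) (F i (Q h v))"
proof -
  have "letter (Gen_q h) * letter (Gen_f i) * letter (Gen_q (- h))
      - scalar (qvar powi (- root_int D i h)) * letter (Gen_f i) \<in> relators D"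
    using assms root_eq_root_int[of h i] unfolding relators_def by blast
  from rep_relator_eq[OF this, of "Q h v"] assms
  have "Q h (F i (Q (- h) (Q h v))) = vscale (qvar powi (- root_int D i h)) (F i (Q h v))"
    by (simp add: carriers rep_mult rep_scalar)
  moreover have "Q (- h) (Q h v) = v"
    using Q_add[of "- h" h v] assms by (simp add: Q_zero lattice_uminus)
  ultimately show ?thesis by simp
qed

lemma E_F_distinct:
  assumes "i \<noteq> j"
  shows "E i (F j v) = F j (E i v)"
proof -
  have "letter (Gen_e i) * letter (Gen_f j) - letter (Gen_f j) * letter (Gen_e i) -
      (if i = j
       then scalar (1 / (qi D i - inverse (qi D i))) *
         (letter (Gen_q (kexp D i)) - letter (Gen_q (- kexp D i)))
       else 0) \<in> relators D"
    unfolding relators_def by blast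
  then have "letter (Gen_e i) * letter (Gen_f j) - letter (Gen_f j) * letter (Gen_e i) \<in> relators D"
    using assms by simp
  from rep_relator_eq[OF this] show ?thesis by (simp add: carriers rep_mult)
qed

lemma E_F_same:
  "E i (F i v) = F i (E i v) + 
    vscale (1 / (qi D i - inverse (qi D i))) (Q (kexp D i) v - Q (- kexp D i) v)"
proof -
  let ?c = "scalar (1 / (qi D i - inverse (qi D i))) *
         (letter (Gen_q (kexp D i)) - letter (Gen_q (- kexp D i)))"
  have "letter (Gen_e i) * letter (Gen_f j) - letter (Gen_f j) * letter (Gen_e i) -
      (if i = j
       then scalar (1 / (qi D i - inverse (qi D i))) *
         (letter (Gen_q (kexp D i)) - letter (Gen_q (- kexp D i)))
       else 0) \<in> relators D" for j
    unfolding relators_def by blast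
  from this[of i]
  have "letter (Gen_e i) * letter (Gen_f i) - letter (Gen_f i) * letter (Gen_e i) - ?c \<in> relators D"
    by simp
  from rep_relator_eq[OF this]
  have "rep (letter (Gen_e i) * letter (Gen_f i) - letter (Gen_f i) * letter (Gen_e i)) v = rep ?c v"
    by (simp add: carriers)
  then show ?thesis
    by (simp add: carriers rep_mult rep_diff rep_scalar diff_eq_eq add.commute)
qed

lemma qi_minus_inverse_nonzero: "qi D i - inverse (qi D i) \<noteq> 0"
proof -
  have "qi D i * qi D i \<noteq> 1"
    using symm_pos[of i] by (simp add: qi_def flip: power_int_add)
  moreover have "qi D i \<noteq> 0" by (simp add: qi_def)
  ultimately show ?thesis by (auto simp: field_simps)
qed

text \<open>For orthogonal simple roots the quantum Serre relation has degree one in the first generator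
  and says that the two generators commute.\<close>

lemma F_commute:
  assumes "i \<noteq> j" "cartan D $ i $ j = 0"
  shows "F i (F j v) = F j (F i v)"
proof -
  have *: "qfact (qi D i) (Suc 0) = 1" "qfact (qi D i) 0 = 1"
    using qi_minus_inverse_nonzero by (simp_all add: qfact_def qint_def)
  have "serre D Gen_f i j = letter (Gen_f i) * letter (Gen_f j) - letter (Gen_f j) * letter (Gen_f i)"
    using assms *
    by (simp add: serre_def qbinom_def scalar_def single_uminus flip: uminus_add_conv_diff)
  moreover have "serre D Gen_f i j \<in> relators D"
    using assms unfolding relators_def by blast
  ultimately show ?thesis
    using rep_relator_eq[of "letter (Gen_f i) * letter (Gen_f j)" "letter (Gen_f j) * letter (Gen_f i)"]
    by (simp add: carriers rep_mult)
qed

text \<open>The elements that preserve a given subspace form a subalgebra.\<close>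

lemma subalgebra_stable:
  assumes "S \<subseteq> generators D" "subspace W"
    and "\<And>g x. g \<in> S \<Longrightarrow> x \<in> W \<Longrightarrow> rep (letter g) x \<in> W"
    and "u \<in> subalgebra_gen D S" "x \<in> W"
  shows "act u x \<in> W"
proof -
  let ?S = "range (uq_scalar D) \<union> uq_gen D ` S"
  have closed: "u \<in> carrier (Uq D)" if "u \<in> generate_ring (Uq D) ?S" for u
    by (rule ring.generate_ring_in_carrier[OF ring_Uq subalgebra_gens_closed[OF assms(1)] that])
  have mod: "\<And>u w v. u \<in> carrier (Uq D) \<Longrightarrow> w \<in> carrier (Uq D) \<Longrightarrow>
      act (u \<oplus>\<^bsub>Uq D\<^esub> w) v = act u v + act w v"
    "\<And>u w v. u \<in> carrier (Uq D) \<Longrightarrow> w \<in> carrier (Uq D) \<Longrightarrow> act (u \<otimes>\<^bsub>Uq D\<^esub> w) v = act u (act w v)"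
    "\<And>v. act \<one>\<^bsub>Uq D\<^esub> v = v"
    using uq_mod by (auto simp: uq_module_def)
  have "u \<in> generate_ring (Uq D) ?S" using assms(4) by (simp add: subalgebra_gen_def)
  then have "\<forall>x\<in>W. act u x \<in> W"
  proof (induction rule: generate_ring.induct)
    case one
    show ?case by (simp add: mod)
  next
    case (incl u)
    then show ?case
      using assms(2,3) uq_mod
      by (auto simp: uq_module_def rep_def uq_gen_def subspace_scale)
  next
    case (a_inv u)
    then show ?case using assms(2) closed by (simp add: act_uminus subspace_neg)
  next
    case (eng_add u w)
    then show ?case using assms(2) closed by (simp add: mod subspace_add)
  next
    case (eng_mult u w)
    then show ?case using closed by (simp add: mod)
  qed
  then show ?thesis using assms(5) by blast
qed

text \<open>The carrier of the quantum group comes from arbitrary finitely supported functions on words, each of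
  which is a finite sum of scalar multiples of products of generators.\<close>

lemma rep_stable:
  assumes "subspace W"
    and "\<And>g x. g \<in> generators D \<Longrightarrow> x \<in> W \<Longrightarrow> rep (letter g) x \<in> W"
    and "x \<in> carrier free" "v \<in> W"
  shows "rep x v \<in> W"
proof -
  have word: "rep (Poly_Mapping.single (Word gs) c) v \<in> W \<and>
      Poly_Mapping.single (Word gs) c \<in> carrier free"
    if "set gs \<subseteq> generators D" for gs c
    using that
  proof (induction gs)
    case Nil
    then show ?case
      using rep_scalar[of c v] assms(1,4) free_algebra_scalar[of c "generators D"]
      by (simp add: scalar_def zero_word_def subspace_scale)
  next
    case (Cons g gs)
    then show ?case
      using assms(2) by (simp add: single_Cons rep_mult carriers)
  qed
  have "rep (\<Sum>k\<in>A. Poly_Mapping.single k (Poly_Mapping.lookup x k)) v \<in> W \<and>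
      (\<Sum>k\<in>A. Poly_Mapping.single k (Poly_Mapping.lookup x k)) \<in> carrier free"
    if "finite A" "A \<subseteq> Poly_Mapping.keys x" for A
    using that
  proof (induction A rule: finite_induct)
    case empty
    have "rep 0 v = 0" using rep_scalar[of 0 v] by (simp add: scalar_def)
    then show ?case using assms(1) by (simp add: subspace_0 free_algebra_zero)
  next
    case (insert k A)
    have "set (letters k) \<subseteq> generators D"
      using insert.prems assms(3) by (auto simp: free_algebra_carrier)
    from word[OF this] insert show ?case
      using assms(1) by (simp add: rep_add subspace_add free_algebra_add)
  qed
  from this[of "Poly_Mapping.keys x"] show ?thesis
    by (simp flip: poly_mapping_eq_sum_single)
qed

end

section \<open>Weights\<close>

text \<open>The extension of a function on the monoid to a linear functional on the monoid algebra.\<close>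

definition linear_ext :: "('m \<Rightarrow> ratfun) \<Rightarrow> ('m \<Rightarrow>\<^sub>0 ratfun) \<Rightarrow> ratfun" where
  "linear_ext f x = (\<Sum>k\<in>Poly_Mapping.keys x. Poly_Mapping.lookup x k * f k)"

lemma linear_ext_superset:
  "finite A \<Longrightarrow> Poly_Mapping.keys x \<subseteq> A \<Longrightarrow>
    linear_ext f x = (\<Sum>k\<in>A. Poly_Mapping.lookup x k * f k)"
  unfolding linear_ext_def by (rule sum.mono_neutral_left) (auto simp: in_keys_iff)

lemma linear_ext_add: "linear_ext f (x + y) = linear_ext f x + linear_ext f y"
proof -
  let ?A = "Poly_Mapping.keys x \<union> Poly_Mapping.keys y"
  have "linear_ext f z = (\<Sum>k\<in>?A. Poly_Mapping.lookup z k * f k)" if "z \<in> {x, y, x + y}" for z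
    using that keys_add[of x y] by (intro linear_ext_superset) auto
  then show ?thesis by (simp add: lookup_add distrib_right sum.distrib)
qed

lemma linear_ext_zero: "linear_ext f 0 = 0"
  by (simp add: linear_ext_def)

lemma linear_ext_sum: "linear_ext f (\<Sum>k\<in>A. g k) = (\<Sum>k\<in>A. linear_ext f (g k))"
  by (induction A rule: infinite_finite_induct) (simp_all add: linear_ext_zero linear_ext_add)

lemma linear_ext_single: "linear_ext f (Poly_Mapping.single k c) = c * f k"
  by (cases "c = 0") (simp_all add: linear_ext_def)

text \<open>Both sides are bilinear, so the claim reduces to basis elements of the monoid algebra.\<close>

lemma linear_ext_mult:
  fixes x y :: "'m::monoid_add \<Rightarrow>\<^sub>0 ratfun"
  assumes "\<And>k l. k \<in> Poly_Mapping.keys x \<Longrightarrow> l \<in> Poly_Mapping.keys y \<Longrightarrow> f (k + l) = f k * f l"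
  shows "linear_ext f (x * y) = linear_ext f x * linear_ext f y"
proof -
  let ?c = "Poly_Mapping.lookup"
  have "linear_ext f (x * y) = linear_ext f
      ((\<Sum>k\<in>Poly_Mapping.keys x. Poly_Mapping.single k (?c x k)) *
       (\<Sum>l\<in>Poly_Mapping.keys y. Poly_Mapping.single l (?c y l)))"
    by (simp flip: poly_mapping_eq_sum_single)
  also have "\<dots> = (\<Sum>k\<in>Poly_Mapping.keys x. \<Sum>l\<in>Poly_Mapping.keys y. ?c x k * ?c y l * f (k + l))"
    by (simp add: sum_product mult_single linear_ext_sum linear_ext_single)
  also have "\<dots> = (\<Sum>k\<in>Poly_Mapping.keys x. \<Sum>l\<in>Poly_Mapping.keys y. (?c x k * f k) * (?c y l * f l))"
    by (intro sum.cong refl) (simp add: assms)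
  also have "\<dots> = linear_ext f x * linear_ext f y"
    by (simp add: linear_ext_def sum_product)
  finally show ?thesis .
qed

context symmetrizable_datum
begin

text \<open>A character of the lattice extends linearly to a homomorphism on its group algebra. This realizes the
  weight of a vector \<open>f\<^sub>w v\<close>, which is given by its values on the lattice, as a weight.\<close>

lemma weight_exists:
  assumes "\<psi> 0 = 1"
    and "\<And>h h'. h \<in> coweights \<Longrightarrow> h' \<in> coweights \<Longrightarrow> \<psi> (h + h') = \<psi> h * \<psi> h'"
  obtains \<mu> where "\<mu> \<in> weights D" "\<And>h. h \<in> coweights \<Longrightarrow> weight_at \<mu> h = \<psi> h"
proof
  let ?G = "carrier (monoid_algebra coweights)"
  let ?\<mu> = "restrict (linear_ext \<psi>) ?G"
  have G: "x \<in> ?G \<longleftrightarrow> Poly_Mapping.keys x \<subseteq> coweights" for x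
    by (simp add: monoid_algebra_def)
  have add: "x + y \<in> ?G" and mult: "x * y \<in> ?G" if "x \<in> ?G" "y \<in> ?G" for x y
    using ring.ring_simprules(1,5)[OF ring_monoid_algebra[OF lattice_zero lattice_add] that]
    by (simp_all add: monoid_algebra_def)
  have "linear_ext \<psi> (x * y) = linear_ext \<psi> x * linear_ext \<psi> y" if "x \<in> ?G" "y \<in> ?G" for x y
    using that assms(2) by (intro linear_ext_mult) (auto simp: G)
  moreover have "Poly_Mapping.single 0 c \<in> ?G" for c
    by (simp add: G lattice_zero)
  ultimately show "?\<mu> \<in> weights D"
    by (simp add: weights_def Let_def add mult linear_ext_add linear_ext_single assms(1))
  show "weight_at ?\<mu> h = \<psi> h" if "h \<in> coweights" for h
    using that by (simp add: weight_at_def G linear_ext_single)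
qed

lemma weight_at_zero: "\<mu> \<in> weights D \<Longrightarrow> weight_at \<mu> 0 = 1"
  by (simp add: weights_def Let_def weight_at_def del: single_one)

lemma weight_at_add:
  assumes "\<mu> \<in> weights D" "h \<in> coweights" "h' \<in> coweights"
  shows "weight_at \<mu> (h + h') = weight_at \<mu> h * weight_at \<mu> h'"
proof -
  have "Poly_Mapping.single h 1 \<in> carrier (monoid_algebra coweights)"
    "Poly_Mapping.single h' 1 \<in> carrier (monoid_algebra coweights)"
    using assms by (simp_all add: monoid_algebra_def)
  then have "\<mu> (Poly_Mapping.single h 1 * Poly_Mapping.single h' 1)
      = \<mu> (Poly_Mapping.single h 1) * \<mu> (Poly_Mapping.single h' 1)"
    using assms(1) unfolding weights_def Let_def by blast
  then show ?thesis by (simp add: weight_at_def mult_single)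
qed

lemma weight_at_nonzero: "\<mu> \<in> weights D \<Longrightarrow> h \<in> coweights \<Longrightarrow> weight_at \<mu> h \<noteq> 0"
  using weight_at_add[of \<mu> h "- h"] weight_at_zero[of \<mu>] by (auto simp: lattice_uminus)

text \<open>The exponent of \<open>K\<^sub>i\<close> is the coroot added to itself \<open>d\<^sub>i\<close> times.\<close>

lemma weight_at_kexp:
  assumes "\<mu> \<in> weights D"
  shows "weight_at \<mu> (kexp D i) = weight_at \<mu> (coroot D i) ^ nat (symm D i)"
proof -
  have "weight_at \<mu> (hscale D (of_nat n) (coroot D i)) = weight_at \<mu> (coroot D i) ^ n" for n
  proof (induction n)
    case 0
    show ?case using assms by (simp add: weight_at_zero)
  next
    case (Suc n)
    have "hscale D (of_nat n) (coroot D i) \<in> coweights"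
      using lattice_coroot_multiple[of "int n" i] by simp
    then show ?case
      using Suc assms by (simp add: H.scale_left_distrib weight_at_add lattice_coroot)
  qed
  from this[of "nat (symm D i)"] show ?thesis
    using symm_pos[of i] by (simp add: kexp_def)
qed

end

context uq_representation
begin

text \<open>The eigenvalue equations involve a weight only through its values on the lattice, so weights are
  treated as functions there.\<close>

definition has_weight :: "('h \<Rightarrow> ratfun) \<Rightarrow> 'v \<Rightarrow> bool" where
  "has_weight \<psi> x \<longleftrightarrow> (\<forall>h\<in>coweights. Q h x = vscale (\<psi> h) x)"

lemma weight_space_eq: "weight_space D vscale act \<mu> = {x. has_weight (weight_at \<mu>) x}"
  by (simp add: weight_space_def has_weight_def rep_def uq_gen_def)

lemma has_weight_unique:
  "has_weight \<psi> x \<Longrightarrow> has_weight \<phi> x \<Longrightarrow> x \<noteq> 0 \<Longrightarrow> h \<in> coweights \<Longrightarrow> \<psi> h = \<phi> h"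
  by (auto simp: has_weight_def)

lemma has_weight_scale: "has_weight \<psi> x \<Longrightarrow> has_weight \<psi> (vscale c x)"
  by (simp add: has_weight_def gen_scale gen_q mult.commute)

lemma has_weight_diff: "has_weight \<psi> x \<Longrightarrow> has_weight \<psi> y \<Longrightarrow> has_weight \<psi> (x - y)"
  by (simp add: has_weight_def module_hom.diff[OF gen_module_hom] gen_q scale_right_diff_distrib)

text \<open>Weight vectors of different weights are linearly independent. In a relation between them, the
  operator \<open>q\<^sup>h - \<psi>(h)\<close> removes a vector of weight \<open>\<psi>\<close> and multiplies each of the others by a
  scalar.\<close>

lemma sum_of_other_weights:
  assumes "finite A" "\<And>u. u \<in> A \<Longrightarrow> has_weight (\<psi> u) u"
    and "\<And>u. u \<in> A \<Longrightarrow> u = 0 \<or> (\<exists>h\<in>coweights. \<psi> u h \<noteq> \<phi> h)"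
    and "has_weight \<phi> (\<Sum>u\<in>A. vscale (c u) u)"
  shows "(\<Sum>u\<in>A. vscale (c u) u) = 0"
  using assms
proof (induction A arbitrary: c rule: finite_induct)
  case empty
  then show ?case by simp
next
  case (insert a A)
  let ?x = "\<Sum>u\<in>insert a A. vscale (c u) u"
  show ?case
  proof (cases "a = 0")
    case True
    then have eq: "?x = (\<Sum>u\<in>A. vscale (c u) u)"
      using insert.hyps by simp
    show ?thesis
      unfolding eq using insert.prems unfolding eq by (intro insert.IH) auto
  next
    case False
    then obtain h where h: "h \<in> coweights" "\<psi> a h \<noteq> \<phi> h" using insert.prems(2) by blast
    \<comment> \<open>The operator \<open>q\<^sup>h - \<psi>\<^sub>a(h)\<close> removes \<open>a\<close> from the sum and scales its value by a nonzero factor.\<close>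
    have "vscale (\<phi> h - \<psi> a h) ?x = Q h ?x - vscale (\<psi> a h) ?x"
      using insert.prems(3) h by (simp add: has_weight_def scale_left_diff_distrib)
    also have "\<dots> = (\<Sum>u\<in>insert a A. vscale (c u) (Q h u) - vscale (\<psi> a h) (vscale (c u) u))"
      using h by (simp only: gen_sum gen_scale gen_q scale_sum_right sum_subtractf)
    also have "\<dots> = (\<Sum>u\<in>insert a A. vscale ((\<psi> u h - \<psi> a h) * c u) u)"
      using insert.prems(1) h
      by (intro sum.cong refl) (simp add: has_weight_def algebra_simps)
    also have "\<dots> = (\<Sum>u\<in>A. vscale ((\<psi> u h - \<psi> a h) * c u) u)"
      using insert.hyps by simp
    finally have eq: "vscale (\<phi> h - \<psi> a h) ?x = (\<Sum>u\<in>A. vscale ((\<psi> u h - \<psi> a h) * c u) u)" .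
    have "has_weight \<phi> (vscale (\<phi> h - \<psi> a h) ?x)"
      by (rule has_weight_scale[OF insert.prems(3)])
    then have "(\<Sum>u\<in>A. vscale ((\<psi> u h - \<psi> a h) * c u) u) = 0"
      unfolding eq using insert.prems by (intro insert.IH) auto
    then have "vscale (\<phi> h - \<psi> a h) ?x = 0" using eq by simp
    then show ?thesis using h by simp
  qed
qed

text \<open>If no spanning vector had weight \<open>\<phi>\<close>, then \<open>x\<close> would be a sum of vectors of weights other
  than \<open>\<phi>\<close>, and independence would make it vanish.\<close>

lemma weight_vector_in_span:
  assumes "\<And>u. u \<in> S \<Longrightarrow> \<exists>\<psi>. has_weight \<psi> u"
    and "x \<in> span S" "x \<noteq> 0" "has_weight \<phi> x"
  shows "\<exists>u\<in>S. u \<noteq> 0 \<and> has_weight \<phi> u"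
proof (rule ccontr)
  assume neg: "\<not> (\<exists>u\<in>S. u \<noteq> 0 \<and> has_weight \<phi> u)"
  obtain \<psi> where \<psi>: "\<And>u. u \<in> S \<Longrightarrow> has_weight (\<psi> u) u"
    using assms(1) by metis
  obtain A c where A: "finite A" "A \<subseteq> S" "x = (\<Sum>u\<in>A. vscale (c u) u)"
    using assms(2) unfolding span_explicit by blast
  have "u = 0 \<or> (\<exists>h\<in>coweights. \<psi> u h \<noteq> \<phi> h)" if "u \<in> S" for u
    using neg \<psi>[OF that] that by (fastforce simp: has_weight_def)
  then have "(\<Sum>u\<in>A. vscale (c u) u) = 0"
    using A \<psi> assms(4) by (intro sum_of_other_weights[of A \<psi> \<phi>]) auto
  then show False using A assms(3) by simp
qed

end

section \<open>Active components of a graph\<close>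

text \<open>The union of the connected components of the graph on \<open>J\<close> that contain a node with property
  \<open>a\<close>. Growing it edge by edge from those nodes gives the induction used below.\<close>

inductive_set active_hull :: "('a \<Rightarrow> 'a \<Rightarrow> bool) \<Rightarrow> ('a \<Rightarrow> bool) \<Rightarrow> 'a set \<Rightarrow> 'a set"
  for e :: "'a \<Rightarrow> 'a \<Rightarrow> bool" and a :: "'a \<Rightarrow> bool" and J :: "'a set" where
  base: "j \<in> J \<Longrightarrow> a j \<Longrightarrow> j \<in> active_hull e a J"
| step: "k \<in> active_hull e a J \<Longrightarrow> e k l \<Longrightarrow> l \<in> J \<Longrightarrow> l \<in> active_hull e a J"

lemma active_hull_subset: "active_hull e a J \<subseteq> J"
proof
  fix k assume "k \<in> active_hull e a J"
  then show "k \<in> J" by cases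
qed

text \<open>For the direction from left to right: as \<open>J'\<close> contains the hull of \<open>J\<close>, the hull of \<open>J'\<close> contains it
  too. So a node of \<open>J'\<close> with property \<open>a\<close>, or adjacent to the hull of \<open>J\<close>, lies in the hull of \<open>J'\<close>,
  hence in \<open>J\<close>, and therefore in the hull of \<open>J\<close>. For the converse, no edge leads from the hull of \<open>J\<close>
  to the remaining part of \<open>J'\<close>, which contains no node with property \<open>a\<close>.\<close>

lemma active_hull_subset_iff:
  assumes sym: "\<And>i j. e i j \<Longrightarrow> e j i" and sub: "active_hull e a J \<subseteq> J'"
  shows "active_hull e a J' \<subseteq> J \<longleftrightarrow>
    J' \<subseteq> active_hull e a J \<union> {j. \<not> a j \<and> (\<forall>k\<in>active_hull e a J. \<not> e j k)}" (is "_ \<longleftrightarrow> _ \<subseteq> _ \<union> ?d")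
proof
  assume *: "J' \<subseteq> active_hull e a J \<union> ?d"
  have "k \<in> active_hull e a J" if "k \<in> active_hull e a J'" for k
    using that by induction (use * sym in blast)+
  then show "active_hull e a J' \<subseteq> J" using active_hull_subset[of e a J] by blast
next
  assume *: "active_hull e a J' \<subseteq> J"
  have hull: "k \<in> active_hull e a J'" if "k \<in> active_hull e a J" for k
    using that
  proof induction
    case (base j)
    then show ?case using sub by (blast intro: active_hull.intros)
  next
    case (step k l)
    then have "l \<in> active_hull e a J" by (blast intro: active_hull.intros)
    then show ?case using step sub by (blast intro: active_hull.intros)
  qed
  show "J' \<subseteq> active_hull e a J \<union> ?d"
  proof (intro subsetI UnCI)
    fix j assume j: "j \<in> J'" "j \<notin> ?d"
    then consider "a j" | k where "k \<in> active_hull e a J" "e j k" by blast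
    then show "j \<in> active_hull e a J"
    proof cases
      case 1
      with j * show ?thesis by (blast intro: active_hull.intros)
    next
      case (2 k)
      with j hull sym have "j \<in> active_hull e a J'" by (blast intro: active_hull.step)
      with 2 * sym show ?thesis by (blast intro: active_hull.step)
    qed
  qed
qed

lemma (in symmetrizable_datum) dynkin_edge_sym: "dynkin_edge (cartan D) i j \<Longrightarrow> dynkin_edge (cartan D) j i"
  using cartan_eq_0_sym by (auto simp: dynkin_edge_def)

lemma (in symmetrizable_datum) J_min_eq_active_hull:
  "J_min D vscale act lam t J = active_hull (dynkin_edge (cartan D)) (active D vscale act lam t) J"
    (is "_ = active_hull ?e ?a J")
proof -
  let ?R = "{(i, j). i \<in> J \<and> j \<in> J \<and> ?e i j}"
  have "sym ?R" using dynkin_edge_sym by (auto simp: sym_def)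
  then have symR: "(j, i) \<in> ?R\<^sup>*" if "(i, j) \<in> ?R\<^sup>*" for i j
    using sym_rtrancl that by (blast dest: symD)
  have min: "k \<in> J_min D vscale act lam t J \<longleftrightarrow> k \<in> J \<and> (\<exists>j\<in>J. ?a j \<and> (j, k) \<in> ?R\<^sup>*)" for k
  proof
    assume "k \<in> J_min D vscale act lam t J"
    then obtain x j where "x \<in> J" "(x, k) \<in> ?R\<^sup>*" "k \<in> J" "(x, j) \<in> ?R\<^sup>*" "j \<in> J" "?a j"
      by (auto simp: J_min_def dynkin_components_def quotient_def)
    moreover from this have "(j, k) \<in> ?R\<^sup>*" using symR by (meson rtrancl_trans)
    ultimately show "k \<in> J \<and> (\<exists>j\<in>J. ?a j \<and> (j, k) \<in> ?R\<^sup>*)" by blast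
  next
    assume "k \<in> J \<and> (\<exists>j\<in>J. ?a j \<and> (j, k) \<in> ?R\<^sup>*)"
    then show "k \<in> J_min D vscale act lam t J"
      by (auto simp: J_min_def dynkin_components_def quotient_def)
  qed
  show ?thesis
  proof (intro subset_antisym subsetI)
    fix k assume "k \<in> J_min D vscale act lam t J"
    then obtain j where j: "j \<in> J" "?a j" "(j, k) \<in> ?R\<^sup>*" using min by blast
    from j(3) show "k \<in> active_hull ?e ?a J"
      by induction (use j in \<open>auto intro: active_hull.intros\<close>)
  next
    fix k assume "k \<in> active_hull ?e ?a J"
    then show "k \<in> J_min D vscale act lam t J"
    proof induction
      case (base j)
      then show ?case by (auto simp: min)
    next
      case (step k l)
      then have "(k, l) \<in> ?R" by (simp add: min)
      with step show ?case by (auto simp: min intro: rtrancl_into_rtrancl)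
    qed
  qed
qed

section \<open>Highest weight modules\<close>

text \<open>With \<open>[n] = (t\<^sup>n - t\<^sup>-\<^sup>n) / (t - t\<^sup>-\<^sup>1)\<close>, the sum divided by \<open>t - t\<^sup>-\<^sup>1\<close> is
  \<open>- [n + 1] [n]\<close>. For \<open>K v = v\<close> this is the coefficient of \<open>f\<^sup>n v\<close> in
  \<open>e f\<^sup>n\<^sup>+\<^sup>1 v\<close>, nonzero for \<open>n > 0\<close> if \<open>t\<close> is not a root of unity.\<close>

lemma sl2_coefficient:
  fixes t :: "'a::field"
  assumes "t \<noteq> 0"
  shows "(t - inverse t) * (\<Sum>m<Suc n. inverse t ^ (2 * m) - t ^ (2 * m))
    = - ((t ^ Suc n - inverse t ^ Suc n) * (t ^ n - inverse t ^ n))"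
proof (induction n)
  case 0
  show ?case by simp
next
  case (Suc n)
  define u a b where "u = inverse t" and "a = t ^ n" and "b = u ^ n"
  \<comment> \<open>An identity of polynomials up to a multiple of \<open>t u - 1\<close>, which vanishes.\<close>
  have "(t - u) * ((u * b) * (u * b) - (t * a) * (t * a)) - (t * a - u * b) * (a - b)
      = - ((t * (t * a) - u * (u * b)) * (t * a - u * b))
        + (t * u - 1) * (u * b * b + t * a * a - t * a * b - u * a * b)"
    by (simp add: algebra_simps)
  then have alg: "- ((t * a - u * b) * (a - b)) + (t - u) * ((u * b) * (u * b) - (t * a) * (t * a))
      = - ((t * (t * a) - u * (u * b)) * (t * a - u * b))"
    using assms by (simp add: u_def)
  have sq: "inverse t ^ (2 * Suc n) = (u * b) * (u * b)" "t ^ (2 * Suc n) = (t * a) * (t * a)"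
    by (simp_all only: u_def a_def b_def mult_2 power_add power_Suc)
  have "(t - inverse t) * (\<Sum>m<Suc (Suc n). inverse t ^ (2 * m) - t ^ (2 * m))
      = (t - inverse t) * (\<Sum>m<Suc n. inverse t ^ (2 * m) - t ^ (2 * m))
        + (t - inverse t) * (inverse t ^ (2 * Suc n) - t ^ (2 * Suc n))"
    by (simp only: sum.lessThan_Suc[of _ "Suc n"] distrib_left)
  also have "\<dots> = - ((t * a - u * b) * (a - b)) + (t - u) * ((u * b) * (u * b) - (t * a) * (t * a))"
    unfolding Suc sq by (simp only: u_def a_def b_def power_Suc)
  also have "\<dots> = - ((t ^ Suc (Suc n) - inverse t ^ Suc (Suc n)) * (t ^ Suc n - inverse t ^ Suc n))"
    unfolding alg by (simp only: u_def a_def b_def power_Suc)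
  finally show ?case .
qed

locale highest_weight = uq_representation D vscale act
  for D :: "('i::finite, 'h::ab_group_add) km_datum"
    and vscale :: "ratfun \<Rightarrow> 'v::ab_group_add \<Rightarrow> 'v"
    and act :: "('i, 'h) free_elt set \<Rightarrow> 'v \<Rightarrow> 'v" +
  fixes lam :: "'h weight" and v0 :: 'v
  assumes lam: "lam \<in> weights D"
    and v0_nonzero: "v0 \<noteq> 0"
    and v0_weight: "v0 \<in> weight_space D vscale act lam"
    and E_v0': "act (uq_gen D (Gen_e i)) v0 = 0"
    and generated: "\<exists>x\<in>carrier (Uq D). w = act x v0"
begin

lemma E_v0: "E i v0 = 0"
  using E_v0' by (simp add: rep_def uq_gen_def)

text \<open>The first letter acts last.\<close>

definition fword :: "'i list \<Rightarrow> 'v" where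
  "fword w = foldr F w v0"

lemma fword_simps [simp]: "fword [] = v0" "fword (i # w) = F i (fword w)"
  by (simp_all add: fword_def)

text \<open>The weight \<open>\<lambda> q\<^sup>-\<^sup>\<beta>\<close> on the lattice, where \<open>\<beta>\<close> is the sum of the simple roots over the letters of
  \<open>w\<close>.\<close>

definition wordwt :: "'i list \<Rightarrow> 'h \<Rightarrow> ratfun" where
  "wordwt w h = weight_at lam h * qvar powi (- (\<Sum>i\<leftarrow>w. root_int D i h))"

lemma wordwt_zero: "wordwt w 0 = 1"
proof -
  have "root_int D i 0 = 0" for i
    using root_int_add[of 0 0 i] lattice_zero by simp
  then show ?thesis using lam by (simp add: wordwt_def weight_at_zero)
qed

lemma wordwt_add:
  "h \<in> coweights \<Longrightarrow> h' \<in> coweights \<Longrightarrow> wordwt w (h + h') = wordwt w h * wordwt w h'"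
proof -
  assume h: "h \<in> coweights" "h' \<in> coweights"
  then have "(\<Sum>i\<leftarrow>w. root_int D i (h + h')) = (\<Sum>i\<leftarrow>w. root_int D i h) + (\<Sum>i\<leftarrow>w. root_int D i h')"
    by (simp add: root_int_add sum_list_addf)
  then show ?thesis
    using h lam by (simp add: wordwt_def weight_at_add power_int_add power_int_diff power_int_minus
        divide_inverse)
qed

lemma wordwt_uminus: "h \<in> coweights \<Longrightarrow> wordwt w (- h) = inverse (wordwt w h)"
  using wordwt_add[of h "- h" w] wordwt_zero[of w]
  by (metis add.right_inverse inverse_unique lattice_uminus)

lemma fword_weight: "has_weight (wordwt w) (fword w)"
proof (induction w)
  case Nil
  show ?case using v0_weight by (simp add: weight_space_eq wordwt_def has_weight_def)
next
  case (Cons i w)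
  then show ?case
    by (simp add: has_weight_def Q_F gen_scale gen_f wordwt_def power_int_add power_int_diff
        power_int_minus divide_inverse mult_ac)
qed

lemma sum_list_root_int:
  "(\<Sum>i\<leftarrow>w. root_int D i h) = (\<Sum>i\<in>UNIV. int (count_list w i) * root_int D i h)"
proof (induction w)
  case (Cons j w)
  have "(\<Sum>i\<in>UNIV. int (count_list (j # w) i) * root_int D i h)
      = (\<Sum>i\<in>UNIV. (if i = j then root_int D i h else 0) + int (count_list w i) * root_int D i h)"
    by (intro sum.cong) (auto simp: algebra_simps)
  then show ?case using Cons by (simp add: sum.distrib)
qed simp

text \<open>Since \<open>q\<close> is not a root of unity, equal weights have equal exponents at every lattice point, and the
  simple roots are linearly independent on the lattice.\<close>

lemma wordwt_inject:
  assumes "\<And>h. h \<in> coweights \<Longrightarrow> wordwt w h = wordwt w' h"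
  shows "count_list w i = count_list w' i"
proof -
  have "(\<Sum>i\<in>UNIV. (int (count_list w i) - int (count_list w' i)) * root_int D i h) = 0"
    if "h \<in> coweights" for h
    using assms[OF that] weight_at_nonzero[OF lam that]
    by (simp add: wordwt_def sum_list_root_int left_diff_distrib sum_subtractf)
  from root_int_independent[OF this] show ?thesis by simp
qed

lemma fword_same_weight:
  assumes "has_weight (wordwt w) (fword w')" "fword w' \<noteq> 0"
  shows "count_list w i = count_list w' i"
  by (rule wordwt_inject, rule has_weight_unique[OF assms(1) fword_weight assms(2)])

lemma E_F_weight:
  assumes "has_weight \<psi> x"
  shows "E i (F i x) = F i (E i x) +
    vscale ((\<psi> (kexp D i) - \<psi> (- kexp D i)) / (qi D i - inverse (qi D i))) x"
proof -
  have "Q (kexp D i) x = vscale (\<psi> (kexp D i)) x" "Q (- kexp D i) x = vscale (\<psi> (- kexp D i)) x"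
    using assms lattice_kexp[of i] lattice_uminus[OF lattice_kexp[of i]] by (auto simp: has_weight_def)
  then show ?thesis
    by (simp add: E_F_same divide_inverse mult.commute flip: scale_left_diff_distrib)
qed

lemma E_F_fword:
  "E i (F i (fword w)) = F i (E i (fword w)) +
    vscale ((wordwt w (kexp D i) - inverse (wordwt w (kexp D i))) / (qi D i - inverse (qi D i))) (fword w)"
  using E_F_weight[OF fword_weight] by (simp add: wordwt_uminus lattice_kexp)

lemma E_fword_notin: "i \<notin> set w \<Longrightarrow> E i (fword w) = 0"
  by (induction w) (simp_all add: E_v0 E_F_distinct gen_zero gen_f)

definition words_span :: "'i set \<Rightarrow> 'v set" where
  "words_span J = span (fword ` {w. set w \<subseteq> J})"

lemma fword_in_words_span: "set w \<subseteq> J \<Longrightarrow> fword w \<in> words_span J"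
  unfolding words_span_def by (intro span_base imageI CollectI)

lemma subspace_words_span: "subspace (words_span J)"
  unfolding words_span_def by (rule subspace_span)

lemma words_span_stable:
  assumes "g \<in> generators D" "\<And>w. set w \<subseteq> J \<Longrightarrow> rep (letter g) (fword w) \<in> words_span J"
    and "x \<in> words_span J"
  shows "rep (letter g) x \<in> words_span J"
proof (rule gen_span[OF assms(1) subspace_words_span _ assms(3)[unfolded words_span_def]])
  fix u assume "u \<in> fword ` {w. set w \<subseteq> J}"
  then obtain w where "u = fword w" "set w \<subseteq> J" by blast
  then show "rep (letter g) u \<in> words_span J" using assms(2) by blast
qed

lemma Q_words_span:
  assumes "h \<in> coweights" "x \<in> words_span J"
  shows "Q h x \<in> words_span J"
proof (rule words_span_stable[OF gen_q[OF assms(1)] _ assms(2)])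
  fix w assume "set w \<subseteq> J"
  then show "Q h (fword w) \<in> words_span J"
    using fword_weight[of w] assms(1)
    by (simp add: has_weight_def subspace_scale subspace_words_span fword_in_words_span)
qed

lemma F_words_span:
  assumes "i \<in> J" "x \<in> words_span J"
  shows "F i x \<in> words_span J"
  using fword_in_words_span[of "i # _" J] assms(1)
  by (intro words_span_stable[OF gen_f _ assms(2)]) simp

text \<open>Moving \<open>e\<^sub>i\<close> to the right past each \<open>f\<^sub>j\<close> only adds scalar multiples of shorter words, and at the end
  \<open>e\<^sub>i\<close> kills the highest weight vector.\<close>

lemma E_words_span: "x \<in> words_span J \<Longrightarrow> E i x \<in> words_span J"
proof -
  have "E i (fword w) \<in> words_span J" if "set w \<subseteq> J" for w
    using that
  proof (induction w)
    case Nil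
    show ?case by (simp add: E_v0 subspace_0 subspace_words_span)
  next
    case (Cons j w)
    then have w: "set w \<subseteq> J" and IH: "F j (E i (fword w)) \<in> words_span J"
      by (simp_all add: F_words_span)
    show ?case
    proof (cases "i = j")
      case True
      then show ?thesis
        using IH w unfolding fword_simps(2) True E_F_fword
        by (intro subspace_add subspace_scale subspace_words_span fword_in_words_span)
    next
      case False
      then show ?thesis using IH by (simp add: E_F_distinct)
    qed
  qed
  then show "x \<in> words_span J \<Longrightarrow> E i x \<in> words_span J"
    by (rule words_span_stable[OF gen_e])
qed

lemma words_span_UNIV: "x \<in> words_span UNIV"
proof -
  obtain u where u: "u \<in> carrier (Uq D)" "x = act u v0" using generated by blast
  from u(1) obtain y where y: "y \<in> carrier free" "u = uq_class D y" by (rule Uq_carrierE)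
  have stable: "rep (letter g) z \<in> words_span UNIV"
    if "g \<in> generators D" "z \<in> words_span UNIV" for g z
    using that(1) unfolding generators_def
    by (elim UnE imageE) (simp_all add: that(2) E_words_span F_words_span Q_words_span)
  have "v0 \<in> words_span UNIV" using fword_in_words_span[of "[]"] by simp
  from rep_stable[OF subspace_words_span stable y(1) this] show ?thesis
    by (simp add: rep_def u y)
qed

text \<open>All nonempty words have weights different from \<open>\<lambda>\<close>, so a vector of weight \<open>\<lambda>\<close> has no component
  outside the line of the highest weight vector.\<close>

lemma highest_weight_space: "weight_space D vscale act lam = span {v0}"
proof (intro subset_antisym subsetI)
  fix x assume "x \<in> span {v0}"
  then obtain c where "x = vscale c v0" by (auto simp: span_singleton)
  then show "x \<in> weight_space D vscale act lam"
    using v0_weight by (simp add: weight_space_eq has_weight_scale)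
next
  fix x assume x: "x \<in> weight_space D vscale act lam"
  have sub: "fword ` {w. set w \<subseteq> UNIV} \<subseteq> insert v0 (fword ` {w. w \<noteq> []})"
  proof (rule image_subsetI)
    fix w
    show "fword w \<in> insert v0 (fword ` {w. w \<noteq> []})"
      by (cases "w = []") (simp, blast)
  qed
  have "x \<in> span (insert v0 (fword ` {w. w \<noteq> []}))"
    by (rule subsetD[OF span_mono[OF sub] words_span_UNIV[unfolded words_span_def]])
  then obtain c where c: "x - vscale c v0 \<in> span (fword ` {w. w \<noteq> []})"
    by (auto simp: span_insert)
  have "x - vscale c v0 = 0"
  proof (rule ccontr)
    assume "x - vscale c v0 \<noteq> 0"
    moreover have "has_weight (weight_at lam) (x - vscale c v0)"
      using x v0_weight by (simp add: weight_space_eq has_weight_diff has_weight_scale)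
    moreover have "\<exists>\<psi>. has_weight \<psi> u" if "u \<in> fword ` {w. w \<noteq> []}" for u
      using that fword_weight by blast
    ultimately obtain u where "u \<in> fword ` {w. w \<noteq> []}" "u \<noteq> 0" "has_weight (weight_at lam) u"
      using weight_vector_in_span[OF _ c] by meson
    then obtain w where w: "w \<noteq> []" "fword w \<noteq> 0" "has_weight (weight_at lam) (fword w)"
      by blast
    have "has_weight (wordwt []) (fword w)"
      using w(3) by (simp add: has_weight_def wordwt_def)
    from fword_same_weight[OF this w(2), of "hd w"] w(1) show False
      by (cases w) auto
  qed
  then show "x \<in> span {v0}" by (auto simp: span_singleton)
qed

lemma fword_in_orbit:
  assumes "Gen_f ` J \<subseteq> S" "S \<subseteq> generators D" "set w \<subseteq> J"
  shows "\<exists>u\<in>subalgebra_gen D S. fword w = act u v0"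
  using assms(3)
proof (induction w)
  case Nil
  have "\<one>\<^bsub>Uq D\<^esub> \<in> subalgebra_gen D S" "act \<one>\<^bsub>Uq D\<^esub> v0 = v0"
    using uq_mod by (simp_all add: subalgebra_gen_def generate_ring.one uq_module_def)
  then show ?case by (intro bexI) simp_all
next
  case (Cons i w)
  then obtain u where u: "u \<in> subalgebra_gen D S" "fword w = act u v0" by auto
  let ?f = "uq_gen D (Gen_f i)"
  have f: "?f \<in> subalgebra_gen D S"
    using Cons.prems assms(1) unfolding subalgebra_gen_def by (intro generate_ring.incl) auto
  have "subalgebra_gen D S \<subseteq> carrier (Uq D)"
    unfolding subalgebra_gen_def
    by (rule ring.generate_ring_incl[OF ring_Uq subalgebra_gens_closed[OF assms(2)]])
  then have "act (?f \<otimes>\<^bsub>Uq D\<^esub> u) v0 = act ?f (act u v0)"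
    using u f uq_mod unfolding uq_module_def by blast
  moreover have "?f \<otimes>\<^bsub>Uq D\<^esub> u \<in> subalgebra_gen D S"
    using f u unfolding subalgebra_gen_def by (intro generate_ring.eng_mult)
  ultimately show ?case
    using u by (intro bexI[of _ "?f \<otimes>\<^bsub>Uq D\<^esub> u"]) (simp_all add: rep_def uq_gen_def)
qed

text \<open>This covers the Levi subalgebras as well as the subalgebra generated by a single \<open>f\<^sub>i\<close>, through
  which integrability is defined.\<close>

lemma act_span_highest_weight_space:
  assumes "Gen_f ` J \<subseteq> S" "S \<subseteq> generators D"
    and "\<And>g x. g \<in> S \<Longrightarrow> x \<in> words_span J \<Longrightarrow> rep (letter g) x \<in> words_span J"
  shows "act_span vscale act (subalgebra_gen D S) (weight_space D vscale act lam) = words_span J"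
proof (rule subset_antisym)
  have "span {v0} \<subseteq> words_span J"
    using fword_in_words_span[of "[]" J] by (intro span_minimal subspace_words_span) auto
  moreover have "act u w \<in> words_span J" if "u \<in> subalgebra_gen D S" "w \<in> words_span J" for u w
    by (rule subalgebra_stable[OF assms(2) subspace_words_span assms(3) that])
  ultimately have "{act u w |u w. u \<in> subalgebra_gen D S \<and> w \<in> span {v0}} \<subseteq> words_span J"
    by blast
  then show "act_span vscale act (subalgebra_gen D S) (weight_space D vscale act lam) \<subseteq> words_span J"
    unfolding act_span_def highest_weight_space by (intro span_minimal subspace_words_span)
  have "fword w \<in> {act u w |u w. u \<in> subalgebra_gen D S \<and> w \<in> span {v0}}" if "set w \<subseteq> J" for w
    using fword_in_orbit[OF assms(1,2) that] span_base[of v0 "{v0}"] by blast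
  then show "words_span J \<subseteq> act_span vscale act (subalgebra_gen D S) (weight_space D vscale act lam)"
    unfolding act_span_def highest_weight_space words_span_def by (intro span_mono) blast
qed

lemma wt_levi_iff:
  "\<mu> \<in> wt_levi D vscale act lam J \<longleftrightarrow>
    \<mu> \<in> weights D \<and> (\<exists>w. set w \<subseteq> J \<and> fword w \<noteq> 0 \<and> has_weight (weight_at \<mu>) (fword w))"
proof -
  have "act_span vscale act (Uq_levi D J) (weight_space D vscale act lam) = words_span J"
    unfolding Uq_levi_def
    by (rule act_span_highest_weight_space)
       (auto simp: gen_e gen_f gen_q E_words_span F_words_span Q_words_span)
  then have "\<mu> \<in> wt_levi D vscale act lam J \<longleftrightarrow>
      \<mu> \<in> weights D \<and> (\<exists>x\<in>words_span J. x \<noteq> 0 \<and> has_weight (weight_at \<mu>) x)"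
    by (auto simp: wt_levi_def wt_def weight_space_eq)
  moreover have "\<exists>w. set w \<subseteq> J \<and> fword w \<noteq> 0 \<and> has_weight (weight_at \<mu>) (fword w)"
    if "x \<in> words_span J" "x \<noteq> 0" "has_weight (weight_at \<mu>) x" for x
  proof -
    have "\<exists>\<psi>. has_weight \<psi> u" if "u \<in> fword ` {w. set w \<subseteq> J}" for u
      using that fword_weight by blast
    from weight_vector_in_span[OF this that[unfolded words_span_def]] show ?thesis by blast
  qed
  ultimately show ?thesis using fword_in_words_span by blast
qed

definition levi_support :: "'i set \<Rightarrow> 'i set" where
  "levi_support J = \<Union> {set w |w. set w \<subseteq> J \<and> fword w \<noteq> 0}"

text \<open>The set of letters of \<open>w\<close> can be read off from the weight of \<open>f\<^sub>w v\<close>. So if this weight occurs for \<open>J'\<close>,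
  the letters of \<open>w\<close> lie in \<open>J'\<close>; and if they do, then \<open>w\<close> itself is a word over \<open>J'\<close>.\<close>

lemma wt_levi_subset_iff:
  "wt_levi D vscale act lam J \<subseteq> wt_levi D vscale act lam J' \<longleftrightarrow> levi_support J \<subseteq> J'"
proof
  assume *: "wt_levi D vscale act lam J \<subseteq> wt_levi D vscale act lam J'"
  show "levi_support J \<subseteq> J'"
  proof
    fix k assume "k \<in> levi_support J"
    then obtain w where w: "set w \<subseteq> J" "fword w \<noteq> 0" "k \<in> set w" by (auto simp: levi_support_def)
    obtain \<mu> where \<mu>: "\<mu> \<in> weights D" "\<And>h. h \<in> coweights \<Longrightarrow> weight_at \<mu> h = wordwt w h"
      using weight_exists[of "wordwt w"] wordwt_zero wordwt_add by blast
    have eq: "has_weight (weight_at \<mu>) = has_weight (wordwt w)"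
      using \<mu>(2) by (auto simp: fun_eq_iff has_weight_def)
    have "\<mu> \<in> wt_levi D vscale act lam J"
      using w \<mu> fword_weight[of w] unfolding wt_levi_iff eq by blast
    then have "\<mu> \<in> wt_levi D vscale act lam J'" using * by blast
    then obtain w' where w': "set w' \<subseteq> J'" "fword w' \<noteq> 0" "has_weight (wordwt w) (fword w')"
      unfolding wt_levi_iff eq by blast
    have "count_list w k = count_list w' k"
      by (rule fword_same_weight[OF w'(3,2)])
    then have "k \<in> set w'" using w(3) by (metis count_list_0_iff)
    then show "k \<in> J'" using w' by blast
  qed
next
  assume "levi_support J \<subseteq> J'"
  then show "wt_levi D vscale act lam J \<subseteq> wt_levi D vscale act lam J'"
    unfolding levi_support_def wt_levi_iff subset_iff by blast
qed

section \<open>Integrable nodes\<close>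

lemma integrability_iff:
  "i \<in> integrability D vscale act lam \<longleftrightarrow> (\<exists>B. finite B \<and> span B = words_span {i})"
proof -
  have "act_span vscale act (subalgebra_gen D {Gen_f i}) (weight_space D vscale act lam) = words_span {i}"
    by (rule act_span_highest_weight_space) (simp_all add: gen_f F_words_span)
  then show ?thesis by (simp add: integrability_def)
qed

text \<open>If \<open>f\<^sub>i\<close> kills \<open>v\<close>, the orbit of \<open>v\<close> under \<open>f\<^sub>i\<close> is the line through \<open>v\<close>.\<close>

lemma F_v0_zero_integrable:
  assumes "F i v0 = 0"
  shows "i \<in> integrability D vscale act lam"
proof -
  have "fword w \<in> span {v0}" if "set w \<subseteq> {i}" for w
    using that
  proof (induction w)
    case Nil
    show ?case by (simp add: span_base)
  next
    case (Cons j w)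
    then have "fword w \<in> span {v0}" by simp
    then have "F i (fword w) \<in> span {v0}"
      by (rule gen_span[OF gen_f subspace_span, rotated]) (simp add: assms span_zero)
    then show ?case using Cons.prems by simp
  qed
  then have "words_span {i} \<subseteq> span {v0}"
    unfolding words_span_def by (intro span_minimal subspace_span) blast
  moreover have "span {v0} \<subseteq> words_span {i}"
    using fword_in_words_span[of "[]" "{i}"] by (intro span_minimal subspace_words_span) simp
  ultimately have "span {v0} = words_span {i}" by (rule subset_antisym[rotated])
  then show ?thesis unfolding integrability_iff by blast
qed

text \<open>The vectors \<open>f\<^sub>i\<^sup>n v\<close> have distinct weights. If all of them were nonzero, they would be infinitely
  many independent vectors in a space of finite dimension.\<close>

lemma integrable_nilpotent:
  assumes "i \<in> integrability D vscale act lam"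
  obtains n where "fword (replicate n i) = 0"
proof (rule ccontr)
  assume "\<not> thesis"
  with that have nz: "fword (replicate n i) \<noteq> 0" for n by blast
  let ?f = "\<lambda>n. fword (replicate n i)"
  have eqI: "m = n" if "has_weight (wordwt (replicate m i)) (?f n)" for m n
    using fword_same_weight[OF that nz, of i]
    by (simp add: count_list_eq_length_filter)
  have "inj ?f"
    by (rule injI, rule eqI) (metis fword_weight)
  then have "infinite (range ?f)" by (rule range_inj_infinite)
  moreover have "independent (range ?f)"
    unfolding dependent_def
  proof safe
    fix n assume *: "?f n \<in> span (range ?f - {?f n})"
    have "\<exists>\<psi>. has_weight \<psi> u" if "u \<in> range ?f - {?f n}" for u
      using that fword_weight by blast
    from weight_vector_in_span[OF this * nz fword_weight]
    obtain m where "has_weight (wordwt (replicate n i)) (?f m)" "?f m \<noteq> ?f n" by blast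
    with eqI show False by blast
  qed
  moreover obtain B where "finite B" "span B = words_span {i}"
    using assms unfolding integrability_iff by blast
  moreover have "range ?f \<subseteq> words_span {i}"
    by (intro image_subsetI fword_in_words_span) auto
  ultimately show False using independent_span_bound[of B "range ?f"] by simp
qed

lemma wordwt_replicate_kexp:
  "wordwt (replicate n i) (kexp D i) = weight_at lam (kexp D i) * inverse (qi D i) ^ (2 * n)"
proof -
  have "(\<Sum>j\<leftarrow>replicate n i. root_int D j (kexp D i)) = symm D i * int (2 * n)"
    by (simp add: sum_list_replicate root_int_kexp cartan_diag)
  moreover have "qvar powi (- (symm D i * int (2 * n))) = inverse (qi D i) ^ (2 * n)"
    by (simp only: qi_def power_int_minus power_int_mult power_int_of_nat power_inverse)
  ultimately show ?thesis by (simp only: wordwt_def)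
qed

lemma E_fword_replicate:
  assumes "weight_at lam (kexp D i) = s" "inverse s = s"
  shows "E i (fword (replicate (Suc n) i)) = 
    vscale (s / (qi D i - inverse (qi D i)) *
      (\<Sum>m<Suc n. inverse (qi D i) ^ (2 * m) - qi D i ^ (2 * m))) (fword (replicate n i))"
proof -
  let ?t = "qi D i"
  have wt: "wordwt (replicate n i) (kexp D i) - inverse (wordwt (replicate n i) (kexp D i))
      = s * (inverse ?t ^ (2 * n) - ?t ^ (2 * n))" for n
    using assms by (simp add: wordwt_replicate_kexp right_diff_distrib power_inverse)
  show ?thesis
  proof (induction n)
    case 0
    show ?case using E_F_fword[of i "[]"] wt[of 0] by (simp add: E_v0 gen_zero gen_f)
  next
    case (Suc n)
    have "E i (fword (replicate (Suc (Suc n)) i)) = F i (E i (fword (replicate (Suc n) i))) +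
        vscale (s * (inverse ?t ^ (2 * Suc n) - ?t ^ (2 * Suc n)) / (?t - inverse ?t))
          (fword (replicate (Suc n) i))"
      using E_F_fword[of i "replicate (Suc n) i"] unfolding wt by simp
    also have "F i (E i (fword (replicate (Suc n) i))) = 
        vscale (s / (?t - inverse ?t) * (\<Sum>m<Suc n. inverse ?t ^ (2 * m) - ?t ^ (2 * m)))
          (fword (replicate (Suc n) i))"
      unfolding Suc by (simp add: gen_scale gen_f)
    finally show ?case
      by (simp only: sum.lessThan_Suc[of _ "Suc n"] distrib_left scale_left_distrib times_divide_eq_left)
  qed
qed

lemma qi_nonzero: "qi D i \<noteq> 0"
  by (simp add: qi_def)

lemma qi_power_neq_inverse: "qi D i ^ Suc n - inverse (qi D i) ^ Suc n \<noteq> 0"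
proof
  assume "qi D i ^ Suc n - inverse (qi D i) ^ Suc n = 0"
  then have "qi D i ^ Suc n = inverse (qi D i ^ Suc n)"
    by (simp only: power_inverse right_minus_eq)
  then have "qi D i ^ Suc n * qi D i ^ Suc n = 1"
    using right_inverse[of "qi D i ^ Suc n"] qi_nonzero[of i] by (metis power_not_zero)
  moreover have "qi D i ^ Suc n * qi D i ^ Suc n = qvar powi (symm D i * int (Suc n + Suc n))"
    by (simp only: qi_def power_int_mult power_int_of_nat power_add)
  ultimately show False using symm_pos[of i] by simp
qed

text \<open>Apply \<open>e\<^sub>i\<close> to \<open>f\<^sub>i v = 0\<close>: the eigenvalue \<open>s\<close> of \<open>K\<^sub>i\<close> on \<open>v\<close> satisfies \<open>s = s\<^sup>-\<^sup>1\<close>.\<close>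

lemma F_v0_zero_weight:
  assumes "F i v0 = 0"
  shows "weight_at lam (kexp D i) \<in> {1, - 1}"
proof -
  let ?s = "weight_at lam (kexp D i)"
  have "?s - inverse ?s = 0"
    using E_F_fword[of i "[]"] assms v0_nonzero qi_minus_inverse_nonzero[of i]
    by (simp add: E_v0 gen_zero gen_e gen_f wordwt_def)
  then have "?s * ?s = 1"
    using weight_at_nonzero[OF lam lattice_kexp[of i]] by (simp add: field_simps)
  then show ?thesis by (simp add: square_eq_1_iff)
qed

text \<open>If \<open>K\<^sub>i\<close> acts on \<open>v\<close> by \<open>\<plusminus>1\<close>, then \<open>e\<^sub>i f\<^sub>i\<^sup>n\<^sup>+\<^sup>1 v\<close> is a nonzero multiple of \<open>f\<^sub>i\<^sup>n v\<close> for every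
  \<open>n > 0\<close>. So once \<open>f\<^sub>i v\<close> is nonzero, all \<open>f\<^sub>i\<^sup>n v\<close> are, which contradicts integrability.\<close>

lemma integrable_F_v0_zero:
  assumes "i \<in> integrability D vscale act lam" "weight_at lam (kexp D i) \<in> {1, - 1}"
  shows "F i v0 = 0"
proof (rule ccontr)
  assume nz: "F i v0 \<noteq> 0"
  have "fword (replicate (Suc n) i) \<noteq> 0" for n
  proof (induction n)
    case 0
    show ?case using nz by simp
  next
    case (Suc n)
    let ?t = "qi D i" and ?s = "weight_at lam (kexp D i)"
    let ?c = "\<Sum>m<Suc (Suc n). inverse ?t ^ (2 * m) - ?t ^ (2 * m)"
    have "(?t - inverse ?t) * ?c \<noteq> 0"
      unfolding sl2_coefficient[OF qi_nonzero] using qi_power_neq_inverse[of i n] qi_power_neq_inverse[of i "Suc n"]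
      by (simp only: neg_equal_0_iff_equal mult_eq_0_iff) blast
    then have "?s / (?t - inverse ?t) * ?c \<noteq> 0"
      using weight_at_nonzero[OF lam lattice_kexp[of i]] by auto
    moreover have "inverse ?s = ?s" using assms(2) by auto
    ultimately have "E i (fword (replicate (Suc (Suc n)) i)) \<noteq> 0"
      using Suc unfolding E_fword_replicate[OF refl \<open>inverse ?s = ?s\<close>] scale_eq_0_iff by blast
    then show ?case using gen_zero[OF gen_e] by metis
  qed
  moreover obtain n where "fword (replicate n i) = 0"
    using integrable_nilpotent[OF assms(1)] .
  ultimately show False using v0_nonzero by (cases n) auto
qed

lemma active_kexp_iff: "active D vscale act lam (kexp D) i \<longleftrightarrow> F i v0 \<noteq> 0"
  using F_v0_zero_integrable F_v0_zero_weight integrable_F_v0_zero by (auto simp: active_def)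

section \<open>The letters of nonvanishing words\<close>

lemma F_fword_commute:
  assumes "\<And>j. j \<in> set w \<Longrightarrow> i \<noteq> j \<and> \<not> dynkin_edge (cartan D) i j"
  shows "F i (fword w) = foldr F w (F i v0)"
  using assms
proof (induction w)
  case (Cons j w)
  then have "F i (F j (fword w)) = F j (F i (fword w))"
    by (intro F_commute) (auto simp: dynkin_edge_def)
  moreover have "F i (fword w) = foldr F w (F i v0)"
    by (rule Cons.IH) (simp add: Cons.prems)
  ultimately show ?case by simp
qed simp

text \<open>Induction on the word: if all letters of \<open>w\<close> are in the hull and \<open>i\<close> is not, then \<open>i\<close> is
  neither active nor adjacent to a letter of \<open>w\<close>, so \<open>f\<^sub>i f\<^sub>w v = f\<^sub>w f\<^sub>i v = 0\<close>.\<close>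

lemma fword_nonzero_hull:
  assumes "set w \<subseteq> J" "fword w \<noteq> 0"
  shows "set w \<subseteq> active_hull (dynkin_edge (cartan D)) (\<lambda>i. F i v0 \<noteq> 0) J"
  using assms
proof (induction w)
  case (Cons i w)
  let ?H = "active_hull (dynkin_edge (cartan D)) (\<lambda>i. F i v0 \<noteq> 0) J"
  have "fword w \<noteq> 0" using Cons.prems(2) gen_zero[OF gen_f, of i] by auto
  then have w: "set w \<subseteq> ?H" using Cons by simp
  have "i \<in> ?H"
  proof (rule ccontr)
    assume i: "i \<notin> ?H"
    have "F i v0 = 0" using i Cons.prems(1) by (auto intro: active_hull.base)
    moreover have "\<not> dynkin_edge (cartan D) i j" if "j \<in> set w" for j
      using i w that Cons.prems(1) dynkin_edge_sym by (auto intro: active_hull.step)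
    then have "F i (fword w) = foldr F w (F i v0)"
      using i w by (intro F_fword_commute) auto
    moreover have "foldr F w 0 = 0"
      by (induction w) (simp_all add: gen_zero gen_f)
    ultimately show False using Cons.prems(2) by simp
  qed
  then show ?case using w by simp
qed simp

text \<open>As \<open>k\<close> does not occur in \<open>w\<close>, the vector \<open>f\<^sub>w v\<close> is killed by \<open>e\<^sub>k\<close>. If \<open>f\<^sub>k\<close> killed it as well, the
  eigenvalue of \<open>K\<^sub>k\<close> on it would be its own inverse. But this eigenvalue is \<open>\<plusminus>1\<close> times a
  power of \<open>q\<close> whose exponent is a sum of terms \<open>- d\<^sub>k a\<^sub>k\<^sub>i \<ge> 0\<close>, with a positive one for the
  neighbour \<open>j\<close> of \<open>k\<close>.\<close>

lemma F_fword_nonzero: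
  assumes "F k v0 = 0" "fword w \<noteq> 0" "k \<notin> set w" "j \<in> set w" "dynkin_edge (cartan D) k j"
  shows "F k (fword w) \<noteq> 0"
proof
  assume zero: "F k (fword w) = 0"
  let ?\<kappa> = "wordwt w (kexp D k)" and ?n = "\<Sum>i\<leftarrow>w. root_int D i (kexp D k)"
  have "?\<kappa> - inverse ?\<kappa> = 0"
    using E_F_fword[of k w] zero assms(2,3) qi_minus_inverse_nonzero[of k]
    by (simp add: E_fword_notin gen_zero gen_e gen_f)
  moreover have "?\<kappa> \<noteq> 0"
    using weight_at_nonzero[OF lam lattice_kexp[of k]] by (simp add: wordwt_def)
  ultimately have "?\<kappa> * ?\<kappa> = 1" by (simp add: field_simps)
  moreover have "?\<kappa> * ?\<kappa> = qvar powi (- ?n + - ?n)"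
    using F_v0_zero_weight[OF assms(1)] unfolding wordwt_def
    by (subst power_int_add) auto
  ultimately have "?n = 0" by simp
  moreover have "?n < 0"
  proof -
    have nonpos: "root_int D i (kexp D k) \<le> 0" if "i \<in> set w" for i
      using that assms(3) symm_pos[of k] cartan_nonpos[of k i]
      by (auto simp: root_int_kexp mult_le_0_iff)
    have "cartan D $ k $ j < 0"
      using assms(5) cartan_nonpos[of k j] by (auto simp: dynkin_edge_def)
    then have neg: "root_int D j (kexp D k) < 0"
      using symm_pos[of k] by (simp add: root_int_kexp mult_less_0_iff)
    obtain w1 w2 where w: "w = w1 @ j # w2" using assms(4) by (auto simp: in_set_conv_decomp)
    have "(\<Sum>i\<leftarrow>w1. root_int D i (kexp D k)) \<le> 0" "(\<Sum>i\<leftarrow>w2. root_int D i (kexp D k)) \<le> 0"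
      using nonpos by (auto simp: w intro!: sum_list_nonpos)
    then show ?thesis using neg by (simp add: w)
  qed
  ultimately show False by simp
qed

lemma levi_support_eq:
  "levi_support J = active_hull (dynkin_edge (cartan D)) (\<lambda>i. F i v0 \<noteq> 0) J" (is "_ = ?H")
proof
  show "levi_support J \<subseteq> ?H"
    using fword_nonzero_hull unfolding levi_support_def by blast
  show "?H \<subseteq> levi_support J"
  proof
    have singleton: "l \<in> levi_support J" if "F l v0 \<noteq> 0" "l \<in> J" for l
      using that unfolding levi_support_def by (intro UnionI[of "set [l]"]) (auto intro!: exI[of _ "[l]"])
    fix k assume "k \<in> ?H"
    then show "k \<in> levi_support J"
    proof induction
      case (base j)
      then show ?case by (rule singleton[rotated])
    next
      case (step k l)
      then obtain w where w: "set w \<subseteq> J" "fword w \<noteq> 0" "k \<in> set w" by (auto simp: levi_support_def)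
      show ?case
      proof (cases "F l v0 = 0 \<and> l \<notin> set w")
        case True
        then have "fword (l # w) \<noteq> 0"
          using F_fword_nonzero[of l w k] w step dynkin_edge_sym by auto
        then show ?thesis
          using w step unfolding levi_support_def
          by (intro UnionI[of "set (l # w)"]) (auto intro!: exI[of _ "l # w"])
      next
        case False
        then show ?thesis using singleton step w by (auto simp: levi_support_def)
      qed
    qed
  qed
qed

end

theorem theorem11p3:
  fixes D :: "('i::finite, 'h::ab_group_add) km_datum"
    and vscale :: "ratfun \<Rightarrow> 'v::ab_group_add \<Rightarrow> 'v"
    and act :: "('i, 'h) free_elt set \<Rightarrow> 'v \<Rightarrow> 'v"
    and lam :: "'h weight"
    and J J' :: "'i set"
  assumes "symmetrizable_km D"
    and "highest_weight_module D vscale act lam"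
  shows
    "((\<forall>j\<in>integrability D vscale act lam.
         weight_at lam (kexp D j) \<in> {1, - 1} \<longrightarrow> weight_at lam (coroot D j) \<in> {1, - 1}) \<longrightarrow>
       (wt_levi D vscale act lam J \<subseteq> wt_levi D vscale act lam J' \<longleftrightarrow>
          J_min D vscale act lam (coroot D) J \<subseteq> J') \<and>
       (wt_levi D vscale act lam J = wt_levi D vscale act lam J' \<longleftrightarrow>
          J_min D vscale act lam (coroot D) J \<subseteq> J' \<and> J' \<subseteq> J_max D vscale act lam (coroot D) J)) \<and>
     ((wt_levi D vscale act lam J \<subseteq> wt_levi D vscale act lam J' \<longleftrightarrow>
          J_min D vscale act lam (kexp D) J \<subseteq> J') \<and>
       (wt_levi D vscale act lam J = wt_levi D vscale act lam J' \<longleftrightarrow>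
          J_min D vscale act lam (kexp D) J \<subseteq> J' \<and> J' \<subseteq> J_max D vscale act lam (kexp D) J))"
proof -
  obtain v0 where v0: "v0 \<noteq> 0" "v0 \<in> weight_space D vscale act lam"
      "\<forall>i. act (uq_gen D (Gen_e i)) v0 = 0" "\<forall>w. \<exists>x\<in>carrier (Uq D). w = act x v0"
    and mod: "uq_module D vscale act" "lam \<in> weights D"
    using assms(2) unfolding highest_weight_module_def by blast
  interpret vector_space vscale using mod by (simp add: uq_module_def)
  interpret highest_weight D vscale act lam v0
    by unfold_locales (use assms(1) mod v0 in auto)
  let ?e = "dynkin_edge (cartan D)" and ?wt = "wt_levi D vscale act lam"
  \<comment> \<open>The claim depends on the test elements only through the set of active nodes.\<close>
  have main: "(?wt J \<subseteq> ?wt J' \<longleftrightarrow> J_min D vscale act lam t J \<subseteq> J') \<and>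
      (?wt J = ?wt J' \<longleftrightarrow> J_min D vscale act lam t J \<subseteq> J' \<and> J' \<subseteq> J_max D vscale act lam t J)"
    if t: "\<And>i. active D vscale act lam t i \<longleftrightarrow> F i v0 \<noteq> 0" for t
  proof -
    have min: "J_min D vscale act lam t J = levi_support J" for J
      using t unfolding J_min_eq_active_hull levi_support_eq by presburger
    have "J_d D vscale act lam t J = {j. \<not> active D vscale act lam t j \<and>
        (\<forall>k\<in>J_min D vscale act lam t J. \<not> ?e j k)}"
      by (auto simp: J_d_def active_def)
    then have max: "J_max D vscale act lam t J = levi_support J \<union>
        {j. \<not> F j v0 \<noteq> 0 \<and> (\<forall>k\<in>levi_support J. \<not> ?e j k)}"
      by (simp add: J_max_def min t)
    have "levi_support J' \<subseteq> J \<longleftrightarrow> J' \<subseteq> J_max D vscale act lam t J" if "levi_support J \<subseteq> J'"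
      using active_hull_subset_iff[of ?e "\<lambda>i. F i v0 \<noteq> 0" J J'] that dynkin_edge_sym
      unfolding max levi_support_eq by blast
    then show ?thesis
      unfolding set_eq_subset wt_levi_subset_iff min by blast
  qed
  have "weight_at lam (kexp D j) \<in> {1, - 1}" if "weight_at lam (coroot D j) \<in> {1, - 1}" for j
    using that weight_at_kexp[OF mod(2), of j] by (auto simp: minus_one_power_iff)
  then have "active D vscale act lam (coroot D) i \<longleftrightarrow> F i v0 \<noteq> 0"
    if "\<forall>j\<in>integrability D vscale act lam.
      weight_at lam (kexp D j) \<in> {1, - 1} \<longrightarrow> weight_at lam (coroot D j) \<in> {1, - 1}" for i
    using that unfolding active_kexp_iff[symmetric] active_def by blast
  with main active_kexp_iff show ?thesis by blast
qed

end
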